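(* The Noether symmetry group of the equation $\Delta_{H^1}u+e^u=0$ is the group $G_f=\{T,R,\tilde X,\tilde Y\}$, where $$T=\frac{\partial}{\partial t},\quad R=y\frac{\partial}{\partial x}-x\frac{\partial}{\partial y},\quad \tilde X=\frac{\partial}{\partial x}-2y\frac{\partial}{\partial t},\quad \tilde Y=\frac{\partial}{\partial y}+2x\frac{\partial}{\partial t}.$$ That is, a Lie point symmetry of this equation is a Noether symmetry if and only if it belongs to the Lie algebra generated by $T,R,\tilde X,\tilde Y$.
   Context: Coordinates on $\mathbb{R}^3$ (the Heisenberg group $H^1$) are $(x^1,x^2,x^3)=(x,y,t)$, and $u=u(x,y,t)$ is a smooth real-valued function. The Kohn-Laplace operator is $$\Delta_{H^1}u=u_{xx}+u_{yy}+4(x^2+y^2)u_{tt}+4y\,u_{xt}-4x\,u_{yt}.$$ The equation $\Delta_{H^1}u+e^u=0$ is the Euler-Lagrange equation of the Lagrangian $$\mathcal{L}=\tfrac12u_x^2+\tfrac12u_y^2+2(x^2+y^2)u_t^2+2y\,u_xu_t-2x\,u_yu_t-e^u.$$ A Lie point symmetry is a vector field $S=\xi^i(x,y,t,u)\frac{\partial}{\partial x^i}+\eta(x,y,t,u)\frac{\partial}{\partial u}$ (sum over $i=1,2,3$) whose second prolongation annihilates $\Delta_{H^1}u+e^u$ whenever $\Delta_{H^1}u+e^u=0$. Its first prolongation is $S^{(1)}=S+\eta^{(1)}_i\frac{\partial}{\partial u_i}$, $\eta^{(1)}_i=D_i\eta-(D_i\xi^j)u_j$, where $D_i$ is the total derivative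 with respect to $x^i$ and $u_i=\partial u/\partial x^i$. A Lie point symmetry $S$ is a Noether symmetry if there exists $\varphi=(\varphi^1,\varphi^2,\varphi^3)$, with components functions of $x,y,t,u$ and derivatives of $u$, such that $S^{(1)}\mathcal{L}+\mathcal{L}\,D_i\xi^i=D_i\varphi^i$ identically. Symmetry groups are identified with the infinitesimal generators that generate them. By the known group classification, the Lie point symmetries of $\Delta_{H^1}u+e^u=0$ are the linear combinations of $T,R,\tilde X,\tilde Y$ and $E=x\frac{\partial}{\partial x}+y\frac{\partial}{\partial y}+2t\frac{\partial}{\partial t}-2\frac{\partial}{\partial u}$. *)

theory Defs
  imports "HOL-Analysis.Analysis" "HOL-Library.Multiset"
begin

text \<open>
  Coordinates on the jet spaces of functions \<open>u = u(x\<^sup>1, x\<^sup>2, x\<^sup>3)\<close>.  \<open>Indep i\<close> is \<open>x\<^sup>i\<close>; \<open>Dep \<alpha>\<close> is the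
  derivative \<open>u\<^sub>\<alpha>\<close>, where the multi-index is a multiset of indices, so that \<open>u\<close> is \<open>Dep {#}\<close>, and
  \<open>u\<^sub>i\<^sub>j = u\<^sub>j\<^sub>i\<close> is the single coordinate \<open>Dep {#i, j#}\<close>.
\<close>

datatype coord = Indep 3 | Dep "3 multiset"

type_synonym jet = "coord \<Rightarrow> real"

definition partial :: "coord \<Rightarrow> (jet \<Rightarrow> real) \<Rightarrow> jet \<Rightarrow> real" where
  "partial c f z = deriv (\<lambda>s. f (z(c := s))) (z c)"

definition depends_only_on :: "coord set \<Rightarrow> (jet \<Rightarrow> real) \<Rightarrow> bool" where
  "depends_only_on C f \<longleftrightarrow> (\<forall>z w. (\<forall>c\<in>C. z c = w c) \<longrightarrow> f z = f w)"

text \<open>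
  All iterated partial derivatives exist and are continuous (for the product topology on jets).
  For a function of finitely many coordinates this is the usual notion of a smooth function.
\<close>

definition smooth_jet_fun :: "(jet \<Rightarrow> real) \<Rightarrow> bool" where
  "smooth_jet_fun f \<longleftrightarrow>
     (\<forall>cs. continuous_on UNIV (foldr partial cs f) \<and>
           (\<forall>c z. (\<lambda>s. foldr partial cs f (z(c := s))) differentiable (at (z c))))"

definition differential_function :: "(jet \<Rightarrow> real) \<Rightarrow> bool" where
  "differential_function f \<longleftrightarrow> smooth_jet_fun f \<and> (\<exists>C. finite C \<and> depends_only_on C f)"

definition base_function :: "(jet \<Rightarrow> real) \<Rightarrow> bool" where
  "base_function f \<longleftrightarrow> smooth_jet_fun f \<and> depends_only_on (insert (Dep {#}) (range Indep)) f"

text \<open>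
  The sum runs over the multi-indices with a nonzero contribution, which are finitely many for a
  differential function.
\<close>

definition total_deriv :: "3 \<Rightarrow> (jet \<Rightarrow> real) \<Rightarrow> jet \<Rightarrow> real" where
  "total_deriv i f z =
     partial (Indep i) f z +
     (\<Sum>\<alpha> | partial (Dep \<alpha>) f z \<noteq> 0. z (Dep (add_mset i \<alpha>)) * partial (Dep \<alpha>) f z)"

text \<open>
  \<open>VField \<xi> \<eta>\<close> is \<open>\<xi>\<^sup>i \<partial>/\<partial>x\<^sup>i + \<eta> \<partial>/\<partial>u\<close>.  The coefficients are functions of \<open>(x, y, t, u)\<close>,
  regarded as functions on jets; see \<open>point_vfield\<close>.
\<close>

datatype vfield = VField (xi: "3 \<Rightarrow> jet \<Rightarrow> real") (eta: "jet \<Rightarrow> real")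

definition point_vfield :: "vfield \<Rightarrow> bool" where
  "point_vfield S \<longleftrightarrow> (\<forall>i. base_function (xi S i)) \<and> base_function (eta S)"

definition vf_apply :: "vfield \<Rightarrow> (jet \<Rightarrow> real) \<Rightarrow> jet \<Rightarrow> real" where
  "vf_apply S f z =
     (\<Sum>i\<in>UNIV. xi S i z * partial (Indep i) f z) + eta S z * partial (Dep {#}) f z"

definition eta1 :: "vfield \<Rightarrow> 3 \<Rightarrow> jet \<Rightarrow> real" where
  "eta1 S i z =
     total_deriv i (eta S) z - (\<Sum>j\<in>UNIV. total_deriv i (xi S j) z * z (Dep {#j#}))"

definition eta2 :: "vfield \<Rightarrow> 3 \<Rightarrow> 3 \<Rightarrow> jet \<Rightarrow> real" where
  "eta2 S i j z =
     total_deriv j (eta1 S i) z - (\<Sum>k\<in>UNIV. total_deriv j (xi S k) z * z (Dep {#i, k#}))"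

definition prolong1 :: "vfield \<Rightarrow> (jet \<Rightarrow> real) \<Rightarrow> jet \<Rightarrow> real" where
  "prolong1 S f z = vf_apply S f z + (\<Sum>i\<in>UNIV. eta1 S i z * partial (Dep {#i#}) f z)"

text \<open>Each second order coordinate \<open>u\<^sub>i\<^sub>j = u\<^sub>j\<^sub>i\<close> occurs once.\<close>

definition prolong2 :: "vfield \<Rightarrow> (jet \<Rightarrow> real) \<Rightarrow> jet \<Rightarrow> real" where
  "prolong2 S f z = prolong1 S f z +
     (\<Sum>(i, j)\<in>{(1, 1), (2, 2), (3, 3), (1, 2), (1, 3), (2, 3)}.
        eta2 S i j z * partial (Dep {#i, j#}) f z)"

definition kohn_laplace :: "jet \<Rightarrow> real" where
  "kohn_laplace z =
     (let x = z (Indep 1); y = z (Indep 2) in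
        z (Dep {#1, 1#}) + z (Dep {#2, 2#}) + 4 * (x\<^sup>2 + y\<^sup>2) * z (Dep {#3, 3#})
        + 4 * y * z (Dep {#1, 3#}) - 4 * x * z (Dep {#2, 3#}))"

definition equation_lhs :: "jet \<Rightarrow> real" where
  "equation_lhs z = kohn_laplace z + exp (z (Dep {#}))"

definition lagrangian :: "jet \<Rightarrow> real" where
  "lagrangian z =
     (let x = z (Indep 1); y = z (Indep 2);
          ux = z (Dep {#1#}); uy = z (Dep {#2#}); ut = z (Dep {#3#}) in
        1/2 * ux\<^sup>2 + 1/2 * uy\<^sup>2 + 2 * (x\<^sup>2 + y\<^sup>2) * ut\<^sup>2 + 2 * y * ux * ut - 2 * x * uy * ut
        - exp (z (Dep {#})))"

definition lie_point_symmetry :: "vfield \<Rightarrow> bool" where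
  "lie_point_symmetry S \<longleftrightarrow>
     point_vfield S \<and> (\<forall>z. equation_lhs z = 0 \<longrightarrow> prolong2 S equation_lhs z = 0)"

definition noether_symmetry :: "vfield \<Rightarrow> bool" where
  "noether_symmetry S \<longleftrightarrow>
     lie_point_symmetry S \<and>
     (\<exists>\<phi> :: 3 \<Rightarrow> jet \<Rightarrow> real.
        (\<forall>i. differential_function (\<phi> i)) \<and>
        (\<forall>z. prolong1 S lagrangian z + lagrangian z * (\<Sum>i\<in>UNIV. total_deriv i (xi S i) z)
             = (\<Sum>i\<in>UNIV. total_deriv i (\<phi> i) z)))"

definition vf_zero :: vfield where
  "vf_zero = VField (\<lambda>i z. 0) (\<lambda>z. 0)"

definition vf_add :: "vfield \<Rightarrow> vfield \<Rightarrow> vfield" where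
  "vf_add S S' = VField (\<lambda>i z. xi S i z + xi S' i z) (\<lambda>z. eta S z + eta S' z)"

definition vf_scale :: "real \<Rightarrow> vfield \<Rightarrow> vfield" where
  "vf_scale a S = VField (\<lambda>i z. a * xi S i z) (\<lambda>z. a * eta S z)"

definition vf_bracket :: "vfield \<Rightarrow> vfield \<Rightarrow> vfield" where
  "vf_bracket S S' =
     VField (\<lambda>i z. vf_apply S (xi S' i) z - vf_apply S' (xi S i) z)
            (\<lambda>z. vf_apply S (eta S') z - vf_apply S' (eta S) z)"

inductive_set lie_algebra_generated :: "vfield set \<Rightarrow> vfield set"
  for G :: "vfield set" where
  generator: "S \<in> G \<Longrightarrow> S \<in> lie_algebra_generated G"
| zero: "vf_zero \<in> lie_algebra_generated G"
| add: "S \<in> lie_algebra_generated G \<Longrightarrow> S' \<in> lie_algebra_generated G \<Longrightarrow>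
        vf_add S S' \<in> lie_algebra_generated G"
| scale: "S \<in> lie_algebra_generated G \<Longrightarrow> vf_scale a S \<in> lie_algebra_generated G"
| bracket: "S \<in> lie_algebra_generated G \<Longrightarrow> S' \<in> lie_algebra_generated G \<Longrightarrow>
            vf_bracket S S' \<in> lie_algebra_generated G"

definition vf_base ::
  "(jet \<Rightarrow> real) \<Rightarrow> (jet \<Rightarrow> real) \<Rightarrow> (jet \<Rightarrow> real) \<Rightarrow> (jet \<Rightarrow> real) \<Rightarrow> vfield" where
  "vf_base a b c e = VField (\<lambda>i. if i = 1 then a else if i = 2 then b else c) e"

text \<open>\<open>vf_X\<close> and \<open>vf_Y\<close> are the fields with a tilde, \<open>\<partial>\<^sub>x - 2y \<partial>\<^sub>t\<close> and \<open>\<partial>\<^sub>y + 2x \<partial>\<^sub>t\<close>.\<close>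

definition vf_T :: vfield where
  "vf_T = vf_base (\<lambda>z. 0) (\<lambda>z. 0) (\<lambda>z. 1) (\<lambda>z. 0)"

definition vf_R :: vfield where
  "vf_R = vf_base (\<lambda>z. z (Indep 2)) (\<lambda>z. - z (Indep 1)) (\<lambda>z. 0) (\<lambda>z. 0)"

definition vf_X :: vfield where
  "vf_X = vf_base (\<lambda>z. 1) (\<lambda>z. 0) (\<lambda>z. - 2 * z (Indep 2)) (\<lambda>z. 0)"

definition vf_Y :: vfield where
  "vf_Y = vf_base (\<lambda>z. 0) (\<lambda>z. 1) (\<lambda>z. 2 * z (Indep 1)) (\<lambda>z. 0)"

end

theory Submission
  imports Defs
begin

text \<open>
  Write \<open>X = \<partial>\<^sub>x + 2y \<partial>\<^sub>t\<close> and \<open>Y = \<partial>\<^sub>y - 2x \<partial>\<^sub>t\<close> for the horizontal fields, so that the Lagrangian is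
  \<open>((X u)\<^sup>2 + (Y u)\<^sup>2)/2 - e\<^sup>u\<close>.  The Noether condition alone
  determines the field.  The density \<open>S\<^sup>(\<^sup>1\<^sup>) L + L div \<xi>\<close> is a divergence, so the Euler
  operator annihilates it; as it has order one, it must then be affine in the first derivatives of
  \<open>u\<close>.  Its cubic part gives \<open>\<xi>\<^sub>u = 0\<close> and its quadratic part says that \<open>\<xi>\<close> is
  conformal for the horizontal metric with factor \<open>m = \<eta>\<^sub>u + (div \<xi>)/2 = X \<xi>\<^sup>1 = Y \<xi>\<^sup>2\<close>.  The remaining
  Euler-Lagrange condition equates \<open>-(\<eta> + div \<xi> + \<eta>\<^sub>u) e\<^sup>u\<close> with \<open>X X \<eta> + Y Y \<eta>\<close>, which is affine in \<open>u\<close>;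
  hence \<open>\<eta>\<^sub>u = 0\<close> and \<open>\<eta> = - div \<xi>\<close>.  On the Heisenberg group \<open>div \<xi> = 4m\<close>, whereas now
  \<open>m = (div \<xi>)/2\<close>, so \<open>m = 0\<close> and \<open>\<eta> = 0\<close>; this is what excludes the dilation \<open>E\<close>.  The field is then a
  Killing field, and these are spanned by the four generators.
\<close>

section \<open>Smooth functions on jet space\<close>

lemma mixed_difference_MVT:
  fixes f fs A :: "real \<Rightarrow> real \<Rightarrow> real"
  assumes "\<And>s t. ((\<lambda>s. f s t) has_real_derivative fs s t) (at s)"
    and "\<And>s t. ((\<lambda>t. fs s t) has_real_derivative A s t) (at t)"
    and "h > 0"
  shows "\<exists>s t. a < s \<and> s < a + h \<and> b < t \<and> t < b + h \<and>
           f (a + h) (b + h) - f (a + h) b - f a (b + h) + f a b = h * h * A s t"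
proof -
  \<comment> \<open>The mean value theorem is used first in \<open>s\<close>, for the increment of
    \<open>f\<close> from \<open>b\<close> to \<open>b + h\<close>, and then in \<open>t\<close>,
    for \<open>fs\<close> at the intermediate point found.\<close>
  have "((\<lambda>s. f s (b + h) - f s b) has_real_derivative fs s (b + h) - fs s b) (at s)" for s
    by (intro derivative_intros assms)
  then obtain s where s: "a < s" "s < a + h"
      "(f (a + h) (b + h) - f (a + h) b) - (f a (b + h) - f a b) = (a + h - a) * (fs s (b + h) - fs s b)"
    using MVT2[of a "a + h" "\<lambda>s. f s (b + h) - f s b" "\<lambda>s. fs s (b + h) - fs s b"] \<open>h > 0\<close> by auto
  obtain t where t: "b < t" "t < b + h" "fs s (b + h) - fs s b = (b + h - b) * A s t"
    using MVT2[of b "b + h" "\<lambda>t. fs s t" "\<lambda>t. A s t"] assms by auto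
  show ?thesis
    using s t by (intro exI[of _ s] exI[of _ t]) auto
qed

text \<open>The second difference of \<open>f\<close> over a square of side \<open>h\<close> at
  \<open>(a, b)\<close> is \<open>h * h\<close> times a value of \<open>A\<close>, and also
  \<open>h * h\<close> times a value of \<open>B\<close>, both taken inside the square. As
  \<open>h\<close> shrinks, continuity brings both values to those at \<open>(a, b)\<close>.\<close>

lemma mixed_derivatives_eq:
  fixes f fs ft A B :: "real \<Rightarrow> real \<Rightarrow> real"
  assumes fs: "\<And>s t. ((\<lambda>s. f s t) has_real_derivative fs s t) (at s)"
    and ft: "\<And>s t. ((\<lambda>t. f s t) has_real_derivative ft s t) (at t)"
    and A: "\<And>s t. ((\<lambda>t. fs s t) has_real_derivative A s t) (at t)"
    and B: "\<And>s t. ((\<lambda>s. ft s t) has_real_derivative B s t) (at s)"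
    and contA: "continuous_on UNIV (\<lambda>p. A (fst p) (snd p))"
    and contB: "continuous_on UNIV (\<lambda>p. B (fst p) (snd p))"
  shows "A a b = B a b"
proof -
  have "\<bar>A a b - B a b\<bar> \<le> 0 + e" if "e > 0" for e
  proof -
    have near: "\<exists>d>0. \<forall>s t. dist (s, t) (a, b) < d \<longrightarrow> \<bar>F s t - F a b\<bar> < e / 2"
      if "continuous_on UNIV (\<lambda>p. F (fst p) (snd p))" for F :: "real \<Rightarrow> real \<Rightarrow> real"
      using that[unfolded continuous_on_iff, rule_format, of "(a, b)" "e / 2"] \<open>e > 0\<close>
      by (auto simp: dist_real_def)
    obtain dA where dA: "dA > 0" "\<And>s t. dist (s, t) (a, b) < dA \<Longrightarrow> \<bar>A s t - A a b\<bar> < e / 2"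
      using near[OF contA] by auto
    obtain dB where dB: "dB > 0" "\<And>s t. dist (s, t) (a, b) < dB \<Longrightarrow> \<bar>B s t - B a b\<bar> < e / 2"
      using near[OF contB] by auto
    \<comment> \<open>Inside the square the sum of the coordinate distances is below
      \<open>2 * h\<close>, which is the smaller of the two radii.\<close>
    define h where "h = min dA dB / 2"
    have h: "h > 0" using dA dB by (simp add: h_def)
    have close: "dist (s, t) (a, b) < min dA dB"
      if "a < s" "s < a + h" "b < t" "t < b + h" for s t
    proof -
      have "dist (s, t) (a, b) \<le> \<bar>s - a\<bar> + \<bar>t - b\<bar>"
        by (simp add: dist_Pair_Pair dist_real_def sqrt_sum_squares_le_sum_abs)
      then show ?thesis using that unfolding h_def by linarith
    qed
    obtain s t where st: "a < s" "s < a + h" "b < t" "t < b + h"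
        "f (a + h) (b + h) - f (a + h) b - f a (b + h) + f a b = h * h * A s t"
      using mixed_difference_MVT[OF fs A h] by blast
    obtain t' s' where st': "b < t'" "t' < b + h" "a < s'" "s' < a + h"
        "f (a + h) (b + h) - f a (b + h) - f (a + h) b + f a b = h * h * B s' t'"
      using mixed_difference_MVT[of "\<lambda>t s. f s t" "\<lambda>t s. ft s t" "\<lambda>t s. B s t", OF ft B h] by blast
    have "h * h * A s t = h * h * B s' t'" using st st' by linarith
    then have "A s t = B s' t'" using h by simp
    moreover have "\<bar>A s t - A a b\<bar> < e / 2" using dA(2) close[OF st(1-4)] by simp
    moreover have "\<bar>B s' t' - B a b\<bar> < e / 2" using dB(2) close[OF st'(3,4,1,2)] by simp
    ultimately show ?thesis by linarith
  qed
  then have "\<bar>A a b - B a b\<bar> \<le> 0" by (rule field_le_epsilon)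
  then show ?thesis by simp
qed

text \<open>Iterated partial derivatives of a member of \<open>F\<close> never leave
  \<open>F\<close>, so it suffices to inspect the members themselves.\<close>

lemma smooth_jet_funI:
  assumes "f \<in> F"
    and "\<And>g. g \<in> F \<Longrightarrow> continuous_on UNIV g"
    and "\<And>g c z. g \<in> F \<Longrightarrow> (\<lambda>s. g (z(c := s))) differentiable (at (z c))"
    and "\<And>g c. g \<in> F \<Longrightarrow> partial c g \<in> F"
  shows "smooth_jet_fun f"
proof -
  have "foldr partial cs f \<in> F" for cs
    by (induction cs) (auto intro: assms)
  then show ?thesis
    unfolding smooth_jet_fun_def using assms by blast
qed

lemma smooth_partial [simp, intro]: "smooth_jet_fun f \<Longrightarrow> smooth_jet_fun (partial c f)"
  unfolding smooth_jet_fun_def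
proof (intro allI, goal_cases)
  case (1 cs)
  \<comment> \<open>The iterated partials of \<open>partial c f\<close> are those of
    \<open>f\<close> along lists that end in \<open>c\<close>.\<close>
  then show ?case by (auto dest: spec[of _ "cs @ [c]"])
qed

lemma smooth_continuous: "smooth_jet_fun f \<Longrightarrow> continuous_on UNIV f"
  unfolding smooth_jet_fun_def by (auto dest: spec[of _ "[]"])

lemma smooth_differentiable: "smooth_jet_fun f \<Longrightarrow> (\<lambda>s. f (z(c := s))) differentiable (at (z c))"
  unfolding smooth_jet_fun_def by (auto dest: spec[of _ "[]"])

lemma smooth_has_partial:
  assumes "smooth_jet_fun f"
  shows "((\<lambda>s. f (z(c := s))) has_real_derivative partial c f (z(c := t))) (at t)"
  using smooth_differentiable[OF assms, of "z(c := t)" c]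
  by (simp add: partial_def DERIV_deriv_iff_real_differentiable)

lemma smooth_has_partial_at:
  assumes "smooth_jet_fun f"
  shows "((\<lambda>s. f (z(c := s))) has_real_derivative partial c f z) (at (z c))"
  using smooth_has_partial[OF assms, of z c "z c"] by simp

lemma partial_eqI:
  assumes "\<And>z. ((\<lambda>s. f (z(c := s))) has_real_derivative g z) (at (z c))"
  shows "partial c f = g"
  unfolding partial_def by (intro ext DERIV_imp_deriv assms)

text \<open>For \<open>c\<close> different from \<open>d\<close>, the claim reduces to the plane in
  which only \<open>c\<close> and \<open>d\<close> vary. Continuity on jets passes to this plane
  because the product topology is tested coordinate by coordinate.\<close>

lemma partial_commute:
  assumes f: "smooth_jet_fun f"
  shows "partial c (partial d f) = partial d (partial c f)"
proof (cases "c = d")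
  case False
  show ?thesis
  proof
    fix z :: jet
    have upd: "z(c := s, d := t) = z(d := t, c := s)" for s t
      using False by (rule fun_upd_twist)
    have cont: "continuous_on UNIV (\<lambda>p :: real \<times> real. g (z(c := fst p, d := snd p)))"
      if "smooth_jet_fun g" for g
    proof (rule continuous_on_compose2[OF smooth_continuous[OF that]])
      show "continuous_on UNIV (\<lambda>p :: real \<times> real. z(c := fst p, d := snd p))"
      proof (rule continuous_on_coordinatewise_then_product)
        show "continuous_on UNIV (\<lambda>p :: real \<times> real. (z(c := fst p, d := snd p)) e)" for e
          by (cases "e = d"; cases "e = c") (auto intro!: continuous_intros)
      qed
    qed auto
    have s: "((\<lambda>s. g (z(c := s, d := t))) has_real_derivative partial c g (z(c := s, d := t))) (at s)"
      if "smooth_jet_fun g" for g s t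
      unfolding upd by (rule smooth_has_partial[OF that])
    have t: "((\<lambda>t. g (z(c := s, d := t))) has_real_derivative partial d g (z(c := s, d := t))) (at t)"
      if "smooth_jet_fun g" for g s t
      by (rule smooth_has_partial[OF that])
    have "partial d (partial c f) (z(c := z c, d := z d)) = partial c (partial d f) (z(c := z c, d := z d))"
      by (rule mixed_derivatives_eq[where f = "\<lambda>s t. f (z(c := s, d := t))"
            and fs = "\<lambda>s t. partial c f (z(c := s, d := t))" and ft = "\<lambda>s t. partial d f (z(c := s, d := t))"
            and A = "\<lambda>s t. partial d (partial c f) (z(c := s, d := t))"
            and B = "\<lambda>s t. partial c (partial d f) (z(c := s, d := t))"])
         (use f in \<open>auto intro: s t cont\<close>)
    then show "partial c (partial d f) z = partial d (partial c f) z"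
      by simp
  qed
qed simp

section \<open>Rules for partial derivatives and closure properties of smooth functions\<close>

lemma partial_const [simp]: "partial c (\<lambda>z. k) = (\<lambda>z. 0)"
  by (rule partial_eqI) simp

lemma partial_coord: "partial c (\<lambda>z. z d) = (\<lambda>z. if c = d then 1 else 0)"
  by (rule partial_eqI) auto

lemma partial_coord_same [simp]: "partial c (\<lambda>z. z c) = (\<lambda>z. 1)"
  by (simp add: partial_coord)

lemma partial_coord_other [simp]: "c \<noteq> d \<Longrightarrow> partial c (\<lambda>z. z d) = (\<lambda>z. 0)"
  by (simp add: partial_coord)

lemma partial_add [simp]:
  "smooth_jet_fun f \<Longrightarrow> smooth_jet_fun g \<Longrightarrow>
    partial c (\<lambda>z. f z + g z) = (\<lambda>z. partial c f z + partial c g z)"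
  by (rule partial_eqI) (intro derivative_intros smooth_has_partial_at)

lemma partial_mult [simp]:
  "smooth_jet_fun f \<Longrightarrow> smooth_jet_fun g \<Longrightarrow>
    partial c (\<lambda>z. f z * g z) = (\<lambda>z. partial c f z * g z + f z * partial c g z)"
  by (rule partial_eqI)
     (auto intro!: derivative_eq_intros smooth_has_partial_at)

lemma smooth_const [simp, intro]: "smooth_jet_fun (\<lambda>z. k)"
  by (rule smooth_jet_funI[where F = "range (\<lambda>k z. k)"]) auto

lemma smooth_coord [simp, intro]: "smooth_jet_fun (\<lambda>z. z d)"
proof (rule smooth_jet_funI[where F = "insert (\<lambda>z. z d) (range (\<lambda>k z. k))"])
  fix g :: "jet \<Rightarrow> real" and c and z :: jet
  assume "g \<in> insert (\<lambda>z. z d) (range (\<lambda>k z. k))"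
  then show "(\<lambda>s. g (z(c := s))) differentiable (at (z c))"
    by (cases "c = d") auto
qed (auto simp: partial_coord)

lemma partial_exp_coord:
  "partial c (\<lambda>z. exp (z d)) = (if c = d then (\<lambda>z. exp (z d)) else (\<lambda>z. 0))"
  by (rule partial_eqI) (auto intro!: derivative_eq_intros)

lemma partial_exp_coord_same [simp]: "partial c (\<lambda>z. exp (z c)) = (\<lambda>z. exp (z c))"
  by (simp add: partial_exp_coord)

lemma partial_exp_coord_other [simp]: "c \<noteq> d \<Longrightarrow> partial c (\<lambda>z. exp (z d)) = (\<lambda>z. 0)"
  by (simp add: partial_exp_coord)

lemma smooth_exp_coord [simp, intro]: "smooth_jet_fun (\<lambda>z. exp (z d))"
proof (rule smooth_jet_funI[where F = "{\<lambda>z. exp (z d), \<lambda>z. 0}"])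
  fix g :: "jet \<Rightarrow> real" and c and z :: jet
  assume "g \<in> {\<lambda>z. exp (z d), \<lambda>z. 0}"
  moreover have "(\<lambda>s. exp ((z(c := s)) d)) differentiable (at (z c))"
    by (cases "c = d") (auto simp: real_differentiable_def intro!: derivative_eq_intros exI)
  ultimately show "(\<lambda>s. g (z(c := s))) differentiable (at (z c))"
    by auto
qed (auto simp: partial_exp_coord intro!: continuous_intros)

text \<open>
  A set of functions that is closed under partial derivatives can be used in \<open>smooth_jet_funI\<close>; the
  algebra generated by the smooth functions is such a set, which avoids a Leibniz formula for
  iterated derivatives.
\<close>

inductive_set smooth_algebra :: "(jet \<Rightarrow> real) set" where
  base: "smooth_jet_fun f \<Longrightarrow> f \<in> smooth_algebra"
| add: "f \<in> smooth_algebra \<Longrightarrow> g \<in> smooth_algebra \<Longrightarrow> (\<lambda>z. f z + g z) \<in> smooth_algebra"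
| mult: "f \<in> smooth_algebra \<Longrightarrow> g \<in> smooth_algebra \<Longrightarrow> (\<lambda>z. f z * g z) \<in> smooth_algebra"

lemma smooth_algebra_differentiable:
  "f \<in> smooth_algebra \<Longrightarrow> (\<lambda>s. f (z(c := s))) differentiable (at (z c))"
  by (induction rule: smooth_algebra.induct) (auto simp del: fun_upd_apply intro: smooth_differentiable)

lemma smooth_algebra_has_partial_at:
  "f \<in> smooth_algebra \<Longrightarrow> ((\<lambda>s. f (z(c := s))) has_real_derivative partial c f z) (at (z c))"
  using smooth_algebra_differentiable[of f z c]
  by (simp add: partial_def DERIV_deriv_iff_real_differentiable)

lemma smooth_algebra_smooth:
  assumes "f \<in> smooth_algebra"
  shows "smooth_jet_fun f"
proof (rule smooth_jet_funI[where F = smooth_algebra])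
  fix g :: "jet \<Rightarrow> real" and c
  assume "g \<in> smooth_algebra"
  then show "partial c g \<in> smooth_algebra"
  proof (induction rule: smooth_algebra.induct)
    case (add f g)
    have "partial c (\<lambda>z. f z + g z) = (\<lambda>z. partial c f z + partial c g z)"
      by (rule partial_eqI) (intro derivative_intros smooth_algebra_has_partial_at add)
    then show ?case using add by (simp add: smooth_algebra.add)
  next
    case (mult f g)
    have "partial c (\<lambda>z. f z * g z) = (\<lambda>z. partial c f z * g z + f z * partial c g z)"
      by (rule partial_eqI)
         (use mult in \<open>auto intro!: derivative_eq_intros smooth_algebra_has_partial_at\<close>)
    then show ?case using mult by (simp add: smooth_algebra.add smooth_algebra.mult)
  qed (auto intro: smooth_algebra.base)
next
  fix g :: "jet \<Rightarrow> real"
  assume "g \<in> smooth_algebra"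
  then show "continuous_on UNIV g"
    by (induction rule: smooth_algebra.induct) (auto intro!: continuous_on_add continuous_on_mult dest: smooth_continuous)
qed (use assms smooth_algebra_differentiable in auto)

lemma smooth_add [simp, intro]:
  "smooth_jet_fun f \<Longrightarrow> smooth_jet_fun g \<Longrightarrow> smooth_jet_fun (\<lambda>z. f z + g z)"
  by (rule smooth_algebra_smooth[OF smooth_algebra.add[OF smooth_algebra.base smooth_algebra.base]])

lemma smooth_mult [simp, intro]:
  "smooth_jet_fun f \<Longrightarrow> smooth_jet_fun g \<Longrightarrow> smooth_jet_fun (\<lambda>z. f z * g z)"
  by (rule smooth_algebra_smooth[OF smooth_algebra.mult[OF smooth_algebra.base smooth_algebra.base]])

lemma smooth_minus [simp, intro]: "smooth_jet_fun f \<Longrightarrow> smooth_jet_fun (\<lambda>z. - f z)"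
  using smooth_mult[OF smooth_const[of "-1"]] by simp

lemma partial_minus [simp]: "smooth_jet_fun f \<Longrightarrow> partial c (\<lambda>z. - f z) = (\<lambda>z. - partial c f z)"
  by (rule partial_eqI) (intro derivative_intros smooth_has_partial_at)

lemma smooth_diff [simp, intro]:
  "smooth_jet_fun f \<Longrightarrow> smooth_jet_fun g \<Longrightarrow> smooth_jet_fun (\<lambda>z. f z - g z)"
  using smooth_add[OF _ smooth_minus] by simp

lemma partial_diff [simp]:
  "smooth_jet_fun f \<Longrightarrow> smooth_jet_fun g \<Longrightarrow>
    partial c (\<lambda>z. f z - g z) = (\<lambda>z. partial c f z - partial c g z)"
  by (rule partial_eqI) (intro derivative_intros smooth_has_partial_at)

lemma smooth_divide_const [simp, intro]: "smooth_jet_fun f \<Longrightarrow> smooth_jet_fun (\<lambda>z. f z / k)"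
  using smooth_mult[OF _ smooth_const[of "1 / k"]] by simp

lemma partial_divide_const [simp]:
  "smooth_jet_fun f \<Longrightarrow> partial c (\<lambda>z. f z / k) = (\<lambda>z. partial c f z / k)"
  by (rule partial_eqI) (intro DERIV_cdivide smooth_has_partial_at)

lemma smooth_sum [simp, intro]:
  "(\<And>i. i \<in> I \<Longrightarrow> smooth_jet_fun (f i)) \<Longrightarrow> smooth_jet_fun (\<lambda>z. \<Sum>i\<in>I. f i z)"
  by (induction I rule: infinite_finite_induct) auto

lemma partial_sum [simp]:
  "(\<And>i. i \<in> I \<Longrightarrow> smooth_jet_fun (f i)) \<Longrightarrow>
    partial c (\<lambda>z. \<Sum>i\<in>I. f i z) = (\<lambda>z. \<Sum>i\<in>I. partial c (f i) z)"
  by (rule partial_eqI) (intro derivative_intros smooth_has_partial_at)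

lemma partial_zero_imp_upd_eq:
  assumes "smooth_jet_fun f" and "partial c f = (\<lambda>z. 0)"
  shows "f (z(c := s)) = f z"
proof -
  have "f (z(c := s)) = f (z(c := z c))"
    by (rule DERIV_isconst_all[where f = "\<lambda>s. f (z(c := s))"])
       (use smooth_has_partial[OF assms(1), of z c] assms(2) in simp)
  then show ?thesis by simp
qed

section \<open>Differential functions and total derivatives\<close>

lemma depends_only_onD: "depends_only_on C f \<Longrightarrow> (\<And>c. c \<in> C \<Longrightarrow> z c = w c) \<Longrightarrow> f z = f w"
  unfolding depends_only_on_def by blast

lemma partial_eq_zero:
  assumes "depends_only_on C f" and "c \<notin> C"
  shows "partial c f = (\<lambda>z. 0)"
proof (rule partial_eqI)
  fix z
  have "(\<lambda>s. f (z(c := s))) = (\<lambda>s. f z)"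
    by (rule ext, rule depends_only_onD[OF assms(1)]) (use assms(2) in auto)
  then show "((\<lambda>s. f (z(c := s))) has_real_derivative 0) (at (z c))" by simp
qed

lemma depends_only_on_partial:
  assumes "depends_only_on C f"
  shows "depends_only_on C (partial c f)"
proof (cases "c \<in> C")
  case True
  show ?thesis
    unfolding depends_only_on_def
  proof (intro allI impI)
    fix z w :: jet assume zw: "\<forall>c\<in>C. z c = w c"
    have "(\<lambda>s. f (z(c := s))) = (\<lambda>s. f (w(c := s)))"
      by (rule ext, rule depends_only_onD[OF assms]) (use zw in auto)
    then show "partial c f z = partial c f w"
      using zw True by (simp add: partial_def)
  qed
qed (simp add: partial_eq_zero[OF assms] depends_only_on_def)

lemma differential_function_smooth [simp, dest]: "differential_function f \<Longrightarrow> smooth_jet_fun f"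
  by (simp add: differential_function_def)

lemma base_function_smooth [simp, dest]: "base_function f \<Longrightarrow> smooth_jet_fun f"
  by (simp add: base_function_def)

lemma base_function_differential [simp, dest]: "base_function f \<Longrightarrow> differential_function f"
  unfolding base_function_def differential_function_def
  by (meson finite finite_imageI finite_insert)

lemma differential_function_const [simp, intro]: "differential_function (\<lambda>z. k)"
  unfolding differential_function_def depends_only_on_def by auto

lemma differential_function_coord [simp, intro]: "differential_function (\<lambda>z. z d)"
  unfolding differential_function_def depends_only_on_def
  by (intro conjI exI[of _ "{d}"]) auto

lemma differential_function_binary:
  assumes "differential_function f" "differential_function g"
    and "smooth_jet_fun (\<lambda>z. h (f z) (g z))"
  shows "differential_function (\<lambda>z. h (f z) (g z))"
proof -
  obtain C D where "finite C" "depends_only_on C f" "finite D" "depends_only_on D g"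
    using assms by (auto simp: differential_function_def)
  then have "finite (C \<union> D)" "depends_only_on (C \<union> D) (\<lambda>z. h (f z) (g z))"
    by (auto simp: depends_only_on_def) (metis UnCI)
  then show ?thesis using assms unfolding differential_function_def by blast
qed

lemma differential_function_add [simp, intro]:
  "differential_function f \<Longrightarrow> differential_function g \<Longrightarrow> differential_function (\<lambda>z. f z + g z)"
  by (rule differential_function_binary) auto

lemma differential_function_mult [simp, intro]:
  "differential_function f \<Longrightarrow> differential_function g \<Longrightarrow> differential_function (\<lambda>z. f z * g z)"
  by (rule differential_function_binary) auto

lemma differential_function_diff [simp, intro]:
  "differential_function f \<Longrightarrow> differential_function g \<Longrightarrow> differential_function (\<lambda>z. f z - g z)"
  by (rule differential_function_binary) auto

lemma differential_function_minus [simp, intro]: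
  "differential_function f \<Longrightarrow> differential_function (\<lambda>z. - f z)"
  using differential_function_mult[OF differential_function_const[of "-1"]] by simp

lemma differential_function_sum [simp, intro]:
  "(\<And>i. i \<in> I \<Longrightarrow> differential_function (f i)) \<Longrightarrow> differential_function (\<lambda>z. \<Sum>i\<in>I. f i z)"
  by (induction I rule: infinite_finite_induct) auto

lemma differential_function_partial [simp, intro]:
  "differential_function f \<Longrightarrow> differential_function (partial c f)"
  unfolding differential_function_def using depends_only_on_partial by blast

section \<open>The total derivative as a finite sum\<close>

lemma differential_function_support:
  assumes "differential_function f"
  obtains F where "finite F" "\<And>\<alpha>. \<alpha> \<notin> F \<Longrightarrow> partial (Dep \<alpha>) f = (\<lambda>z. 0)"
proof -
  obtain C where C: "finite C" "depends_only_on C f"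
    using assms by (auto simp: differential_function_def)
  show thesis
  proof (rule that[of "Dep -` C"])
    show "finite (Dep -` C)" by (rule finite_vimageI[OF C(1)]) (simp add: inj_def)
  qed (use partial_eq_zero[OF C(2)] in auto)
qed

text \<open>The index set of the defining sum varies with the point. A fixed finite index set turns
  the total derivative into an expression to which the rules for sums and products apply.\<close>

lemma total_deriv_eq:
  assumes "finite F" and "\<And>\<alpha>. \<alpha> \<notin> F \<Longrightarrow> partial (Dep \<alpha>) f = (\<lambda>z. 0)"
  shows "total_deriv i f =
    (\<lambda>z. partial (Indep i) f z + (\<Sum>\<alpha>\<in>F. z (Dep (add_mset i \<alpha>)) * partial (Dep \<alpha>) f z))"
proof
  fix z
  have "(\<Sum>\<alpha> | partial (Dep \<alpha>) f z \<noteq> 0. z (Dep (add_mset i \<alpha>)) * partial (Dep \<alpha>) f z)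
      = (\<Sum>\<alpha>\<in>F. z (Dep (add_mset i \<alpha>)) * partial (Dep \<alpha>) f z)"
    by (rule sum.mono_neutral_left[OF assms(1)]) (use assms(2) in \<open>auto, metis\<close>)
  then show "total_deriv i f z =
      partial (Indep i) f z + (\<Sum>\<alpha>\<in>F. z (Dep (add_mset i \<alpha>)) * partial (Dep \<alpha>) f z)"
    by (simp add: total_deriv_def)
qed

lemma differential_function_total_deriv [simp, intro]:
  assumes "differential_function f"
  shows "differential_function (total_deriv i f)"
proof -
  obtain F where "finite F" "\<And>\<alpha>. \<alpha> \<notin> F \<Longrightarrow> partial (Dep \<alpha>) f = (\<lambda>z. 0)"
    using differential_function_support[OF assms] by metis
  then show ?thesis
    using assms by (simp add: total_deriv_eq)
qed

lemma total_deriv_const [simp]: "total_deriv i (\<lambda>z. k) = (\<lambda>z. 0)"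
  by (simp add: total_deriv_def fun_eq_iff)

lemma total_deriv_Indep: "total_deriv i (\<lambda>z. z (Indep j)) = (\<lambda>z. if i = j then 1 else 0)"
  by (simp add: total_deriv_eq[of "{}"] partial_coord)

lemma total_deriv_Dep [simp]: "total_deriv i (\<lambda>z. z (Dep \<alpha>)) = (\<lambda>z. z (Dep (add_mset i \<alpha>)))"
  by (subst total_deriv_eq[of "{\<alpha>}"]) (auto simp: partial_coord)

lemma differential_function_common_support:
  assumes "differential_function f" "differential_function g"
  obtains F where "finite F" "\<And>\<alpha>. \<alpha> \<notin> F \<Longrightarrow> partial (Dep \<alpha>) f = (\<lambda>z. 0)"
    "\<And>\<alpha>. \<alpha> \<notin> F \<Longrightarrow> partial (Dep \<alpha>) g = (\<lambda>z. 0)"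
proof -
  obtain F where F: "finite F" "\<And>\<alpha>. \<alpha> \<notin> F \<Longrightarrow> partial (Dep \<alpha>) f = (\<lambda>z. 0)"
    using differential_function_support[OF assms(1)] by metis
  obtain G where G: "finite G" "\<And>\<alpha>. \<alpha> \<notin> G \<Longrightarrow> partial (Dep \<alpha>) g = (\<lambda>z. 0)"
    using differential_function_support[OF assms(2)] by metis
  show thesis by (rule that[of "F \<union> G"]) (use F G in auto)
qed

lemma total_deriv_add [simp]:
  assumes "differential_function f" "differential_function g"
  shows "total_deriv i (\<lambda>z. f z + g z) = (\<lambda>z. total_deriv i f z + total_deriv i g z)"
proof -
  obtain F where F: "finite F" "\<And>\<alpha>. \<alpha> \<notin> F \<Longrightarrow> partial (Dep \<alpha>) f = (\<lambda>z. 0)"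
    "\<And>\<alpha>. \<alpha> \<notin> F \<Longrightarrow> partial (Dep \<alpha>) g = (\<lambda>z. 0)"
    using differential_function_common_support[OF assms] by metis
  have "partial (Dep \<alpha>) (\<lambda>z. f z + g z) = (\<lambda>z. 0)" if "\<alpha> \<notin> F" for \<alpha>
    using F that assms by simp
  note total_deriv_eq[OF F(1) this] total_deriv_eq[OF F(1,2)] total_deriv_eq[OF F(1,3)]
  then show ?thesis
    using assms by (simp add: algebra_simps sum.distrib)
qed

lemma total_deriv_mult [simp]:
  assumes "differential_function f" "differential_function g"
  shows "total_deriv i (\<lambda>z. f z * g z) = (\<lambda>z. total_deriv i f z * g z + f z * total_deriv i g z)"
proof -
  obtain F where F: "finite F" "\<And>\<alpha>. \<alpha> \<notin> F \<Longrightarrow> partial (Dep \<alpha>) f = (\<lambda>z. 0)"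
    "\<And>\<alpha>. \<alpha> \<notin> F \<Longrightarrow> partial (Dep \<alpha>) g = (\<lambda>z. 0)"
    using differential_function_common_support[OF assms] by metis
  have "partial (Dep \<alpha>) (\<lambda>z. f z * g z) = (\<lambda>z. 0)" if "\<alpha> \<notin> F" for \<alpha>
    using F that assms by simp
  note total_deriv_eq[OF F(1) this] total_deriv_eq[OF F(1,2)] total_deriv_eq[OF F(1,3)]
  then show ?thesis
    using assms by (simp add: algebra_simps sum.distrib sum_distrib_left)
qed

lemma total_deriv_minus [simp]:
  assumes "differential_function f"
  shows "total_deriv i (\<lambda>z. - f z) = (\<lambda>z. - total_deriv i f z)"
  using total_deriv_mult[OF differential_function_const[of "-1"] assms] by simp

lemma total_deriv_diff [simp]:
  assumes "differential_function f" "differential_function g"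
  shows "total_deriv i (\<lambda>z. f z - g z) = (\<lambda>z. total_deriv i f z - total_deriv i g z)"
  using total_deriv_add[OF assms(1) differential_function_minus[OF assms(2)]] assms(2) by simp

lemma total_deriv_sum [simp]:
  assumes "\<And>k. k \<in> I \<Longrightarrow> differential_function (f k)"
  shows "total_deriv i (\<lambda>z. \<Sum>k\<in>I. f k z) = (\<lambda>z. \<Sum>k\<in>I. total_deriv i (f k) z)"
  using assms by (induction I rule: infinite_finite_induct) auto

lemma total_deriv_base:
  assumes "base_function f"
  shows "total_deriv i f = (\<lambda>z. partial (Indep i) f z + z (Dep {#i#}) * partial (Dep {#}) f z)"
proof -
  have "partial (Dep \<alpha>) f = (\<lambda>z. 0)" if "\<alpha> \<notin> {{#}}" for \<alpha> :: "3 multiset"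
    using assms that unfolding base_function_def by (auto intro!: partial_eq_zero)
  from total_deriv_eq[OF _ this, of "{{#}}"] show ?thesis by simp
qed

text \<open>In the expansion, exchanging \<open>i\<close> and \<open>j\<close> swaps the two mixed
  sums, fixes the coordinates \<open>Dep (add_mset i (add_mset j \<alpha>))\<close> because
  multi-indices are unordered, and transposes the double sum, where second partials commute.\<close>

lemma total_deriv_commute:
  assumes "differential_function f"
  shows "total_deriv i (total_deriv j f) = total_deriv j (total_deriv i f)"
proof -
  obtain F where F: "finite F" "\<And>\<alpha>. \<alpha> \<notin> F \<Longrightarrow> partial (Dep \<alpha>) f = (\<lambda>z. 0)"
    using differential_function_support assms by metis
  have Fp: "partial (Dep \<alpha>) (partial c f) = (\<lambda>z. 0)" if "\<alpha> \<notin> F" for \<alpha> c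
    using F(2)[OF that] assms by (simp add: partial_commute[of f "Dep \<alpha>"])
  have expand: "total_deriv i (total_deriv j f) = (\<lambda>z.
      partial (Indep i) (partial (Indep j) f) z
      + ((\<Sum>\<alpha>\<in>F. z (Dep (add_mset i \<alpha>)) * partial (Dep \<alpha>) (partial (Indep j) f) z)
        + (\<Sum>\<alpha>\<in>F. z (Dep (add_mset j \<alpha>)) * partial (Indep i) (partial (Dep \<alpha>) f) z))
      + (\<Sum>\<alpha>\<in>F. z (Dep (add_mset i (add_mset j \<alpha>))) * partial (Dep \<alpha>) f z)
      + (\<Sum>\<alpha>\<in>F. \<Sum>\<beta>\<in>F. z (Dep (add_mset j \<alpha>)) * (z (Dep (add_mset i \<beta>)) *
          partial (Dep \<beta>) (partial (Dep \<alpha>) f) z)))" for i j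
  proof -
    have "total_deriv i (total_deriv j f) = (\<lambda>z. total_deriv i (partial (Indep j) f) z
      + (\<Sum>\<alpha>\<in>F. z (Dep (add_mset i (add_mset j \<alpha>))) * partial (Dep \<alpha>) f z
          + z (Dep (add_mset j \<alpha>)) * total_deriv i (partial (Dep \<alpha>) f) z))"
      using assms by (subst total_deriv_eq[OF F, of j]) simp_all
    then show ?thesis
      by (simp add: total_deriv_eq[OF F(1) Fp] sum.distrib distrib_left sum_distrib_left algebra_simps)
  qed
  show ?thesis
    unfolding expand[of i j] expand[of j i]
  proof (rule ext, goal_cases)
    case (1 z)
    have "(\<Sum>\<alpha>\<in>F. \<Sum>\<beta>\<in>F. z (Dep (add_mset j \<alpha>)) * (z (Dep (add_mset i \<beta>)) * partial (Dep \<beta>) (partial (Dep \<alpha>) f) z))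
       = (\<Sum>\<alpha>\<in>F. \<Sum>\<beta>\<in>F. z (Dep (add_mset i \<alpha>)) * (z (Dep (add_mset j \<beta>)) * partial (Dep \<beta>) (partial (Dep \<alpha>) f) z))"
      using assms by (subst sum.swap) (simp add: partial_commute[of f "Dep _" "Dep _"] mult.left_commute)
    moreover have "partial (Indep i) (partial (Indep j) f) = partial (Indep j) (partial (Indep i) f)"
      "partial (Indep k) (partial (Dep \<alpha>) f) = partial (Dep \<alpha>) (partial (Indep k) f)" for k \<alpha>
      using assms partial_commute by auto
    ultimately show ?case by (simp add: add_mset_commute add_ac)
  qed
qed

text \<open>The coefficients \<open>Dep (add_mset i \<beta>)\<close> of the total derivative are
  themselves coordinates. One of them is \<open>Dep \<alpha>\<close> exactly when \<beta> is
  \<alpha> with one \<open>i\<close> removed; this is the source of the extra term.\<close>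

lemma partial_Dep_total_deriv:
  assumes "differential_function f"
  shows "partial (Dep \<alpha>) (total_deriv i f) = (\<lambda>z. total_deriv i (partial (Dep \<alpha>) f) z
           + (if i \<in># \<alpha> then partial (Dep (\<alpha> - {#i#})) f z else 0))"
proof -
  obtain F where F: "finite F" "\<And>\<alpha>. \<alpha> \<notin> F \<Longrightarrow> partial (Dep \<alpha>) f = (\<lambda>z. 0)"
    using differential_function_support assms by metis
  have Fp: "partial (Dep \<beta>) (partial (Dep \<alpha>) f) = (\<lambda>z. 0)" if "\<beta> \<notin> F" for \<beta>
    using F(2)[OF that] assms by (simp add: partial_commute[of f "Dep \<beta>"])
  have eq: "\<alpha> = add_mset i \<beta> \<longleftrightarrow> i \<in># \<alpha> \<and> \<beta> = \<alpha> - {#i#}" for \<beta>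
    by (metis add_mset_remove_trivial insert_DiffM union_single_eq_member)
  have "partial (Dep \<alpha>) (total_deriv i f) z = total_deriv i (partial (Dep \<alpha>) f) z
           + (if i \<in># \<alpha> then partial (Dep (\<alpha> - {#i#})) f z else 0)" for z
  proof -
    have "(\<Sum>\<beta>\<in>F. (if \<alpha> = add_mset i \<beta> then 1 else 0) * partial (Dep \<beta>) f z)
        = (\<Sum>\<beta>\<in>F. if \<beta> = \<alpha> - {#i#} then (if i \<in># \<alpha> then partial (Dep \<beta>) f z else 0) else 0)"
      by (rule sum.cong) (auto simp: eq)
    also have "\<dots> = (if i \<in># \<alpha> then partial (Dep (\<alpha> - {#i#})) f z else 0)"
      using F(1) fun_cong[OF F(2)] by simp
    finally show ?thesis
      using assms
      by (simp add: total_deriv_eq[OF F] total_deriv_eq[OF F(1) Fp] partial_coord sum.distrib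
          partial_commute[of f "Dep \<alpha>"])
  qed
  then show ?thesis by (rule ext)
qed

section \<open>The Euler operator annihilates divergences\<close>

text \<open>
  The sum over all multi-indices is restricted to a finite set \<open>A\<close>, which has to contain every
  multi-index with a nonzero contribution.
\<close>

definition total_deriv_multi :: "3 multiset \<Rightarrow> (jet \<Rightarrow> real) \<Rightarrow> jet \<Rightarrow> real" where
  "total_deriv_multi \<alpha> f = (total_deriv 1 ^^ count \<alpha> 1)
     ((total_deriv 2 ^^ count \<alpha> 2) ((total_deriv 3 ^^ count \<alpha> 3) f))"

definition euler_operator :: "3 multiset set \<Rightarrow> (jet \<Rightarrow> real) \<Rightarrow> jet \<Rightarrow> real" where
  "euler_operator A f z = (\<Sum>\<alpha>\<in>A. (-1) ^ size \<alpha> * total_deriv_multi \<alpha> (partial (Dep \<alpha>) f) z)"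

lemma differential_function_total_deriv_pow [simp]:
  "differential_function f \<Longrightarrow> differential_function ((total_deriv i ^^ n) f)"
  by (induction n) auto

lemma total_deriv_pow_commute:
  "differential_function f \<Longrightarrow> total_deriv i ((total_deriv j ^^ n) f) = (total_deriv j ^^ n) (total_deriv i f)"
  by (induction n) (auto simp: total_deriv_commute[of _ i j])

lemma total_deriv_pow_add:
  "differential_function f \<Longrightarrow> differential_function g \<Longrightarrow>
    (total_deriv i ^^ n) (\<lambda>z. f z + g z) = (\<lambda>z. (total_deriv i ^^ n) f z + (total_deriv i ^^ n) g z)"
  by (induction n) auto

lemma total_deriv_pow_zero: "(total_deriv i ^^ n) (\<lambda>z. 0) = (\<lambda>z. 0)"
  by (induction n) auto

lemma total_deriv_multi_zero [simp]: "total_deriv_multi \<alpha> (\<lambda>z. 0) = (\<lambda>z. 0)"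
  by (simp add: total_deriv_multi_def total_deriv_pow_zero)

lemma total_deriv_multi_empty [simp]: "total_deriv_multi {#} f = f"
  by (simp add: total_deriv_multi_def)

lemma total_deriv_multi_add:
  "differential_function f \<Longrightarrow> differential_function g \<Longrightarrow>
    total_deriv_multi \<alpha> (\<lambda>z. f z + g z) = (\<lambda>z. total_deriv_multi \<alpha> f z + total_deriv_multi \<alpha> g z)"
  by (simp add: total_deriv_multi_def total_deriv_pow_add)

text \<open>The definition applies the three directions in a fixed order; commutativity moves the
  additional derivative to the innermost place.\<close>

lemma total_deriv_multi_add_mset:
  assumes "differential_function f"
  shows "total_deriv_multi (add_mset i \<alpha>) f = total_deriv_multi \<alpha> (total_deriv i f)"
  using exhaust_3[of i] assms
  by (auto simp: total_deriv_multi_def total_deriv_pow_commute)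

lemma total_deriv_multi_single:
  "differential_function f \<Longrightarrow> total_deriv_multi {#i#} f = total_deriv i f"
  using total_deriv_multi_add_mset[of f i "{#}"] by simp

lemma euler_operator_add:
  assumes "differential_function f" "differential_function g"
  shows "euler_operator A (\<lambda>z. f z + g z) z = euler_operator A f z + euler_operator A g z"
  using assms by (simp add: euler_operator_def total_deriv_multi_add sum.distrib algebra_simps)

lemma euler_operator_zero: "euler_operator A (\<lambda>z. 0) z = 0"
  by (simp add: euler_operator_def)

lemma euler_operator_sum:
  assumes "\<And>i. i \<in> I \<Longrightarrow> differential_function (f i)"
  shows "euler_operator A (\<lambda>z. \<Sum>i\<in>I. f i z) z = (\<Sum>i\<in>I. euler_operator A (f i) z)"
  using assms
  by (induction I rule: infinite_finite_induct) (auto simp: euler_operator_zero euler_operator_add)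

text \<open>By the commutation rule each term splits into \<open>?g\<close>, and \<open>?h\<close>
  when \<open>i\<close> occurs in \<alpha>. Shifting the index by \<open>i\<close> turns the second
  sum into the negative of the first.\<close>

lemma euler_operator_total_deriv:
  assumes f: "differential_function f"
    and F: "finite F" "\<And>\<alpha>. \<alpha> \<notin> F \<Longrightarrow> partial (Dep \<alpha>) f = (\<lambda>z. 0)"
    and A: "finite A" "F \<subseteq> A" "add_mset i ` F \<subseteq> A"
  shows "euler_operator A (total_deriv i f) z = 0"
proof -
  let ?g = "\<lambda>\<alpha>. (-1) ^ size \<alpha> * total_deriv_multi \<alpha> (total_deriv i (partial (Dep \<alpha>) f)) z"
  let ?h = "\<lambda>\<alpha>. (-1) ^ size \<alpha> * total_deriv_multi \<alpha> (partial (Dep (\<alpha> - {#i#})) f) z"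
  have "euler_operator A (total_deriv i f) z = (\<Sum>\<alpha>\<in>A. ?g \<alpha> + (if i \<in># \<alpha> then ?h \<alpha> else 0))"
    unfolding euler_operator_def
    using f by (intro sum.cong) (auto simp: partial_Dep_total_deriv total_deriv_multi_add distrib_left)
  also have "\<dots> = (\<Sum>\<alpha>\<in>A. ?g \<alpha>) + (\<Sum>\<alpha>\<in>A. if i \<in># \<alpha> then ?h \<alpha> else 0)"
    by (rule sum.distrib)
  also have "(\<Sum>\<alpha>\<in>A. ?g \<alpha>) = (\<Sum>\<alpha>\<in>F. ?g \<alpha>)"
    by (rule sum.mono_neutral_right) (use A F in auto)
  also have "(\<Sum>\<alpha>\<in>A. if i \<in># \<alpha> then ?h \<alpha> else 0) = (\<Sum>\<alpha>\<in>add_mset i ` F. ?h \<alpha>)"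
  proof -
    have "(\<Sum>\<alpha>\<in>A. if i \<in># \<alpha> then ?h \<alpha> else 0) = (\<Sum>\<alpha>\<in>add_mset i ` F. if i \<in># \<alpha> then ?h \<alpha> else 0)"
    proof (rule sum.mono_neutral_right[OF A(1) A(3)], intro ballI)
      fix \<alpha> assume \<alpha>: "\<alpha> \<in> A - add_mset i ` F"
      show "(if i \<in># \<alpha> then ?h \<alpha> else 0) = 0"
      proof (cases "i \<in># \<alpha>")
        case True
        then have "\<alpha> = add_mset i (\<alpha> - {#i#})" by simp
        then have "\<alpha> - {#i#} \<notin> F" using \<alpha> by blast
        then show ?thesis by (simp add: F(2))
      qed simp
    qed
    also have "\<dots> = (\<Sum>\<alpha>\<in>add_mset i ` F. ?h \<alpha>)" by (intro sum.cong) auto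
    finally show ?thesis .
  qed
  \<comment> \<open>Passing from \<alpha> to \<open>add_mset i \<alpha>\<close> raises the size by
    one, which flips the sign, while the additional total derivative is the one present in
    \<open>?g\<close>.\<close>
  also have "(\<Sum>\<alpha>\<in>add_mset i ` F. ?h \<alpha>) = (\<Sum>\<alpha>\<in>F. - ?g \<alpha>)"
    using f by (subst sum.reindex) (auto simp: inj_on_def total_deriv_multi_add_mset)
  finally show ?thesis by (simp add: sum_negf)
qed

text \<open>For a divergence of order at most one, the vanishing Euler expression reduces to the
  empty multi-index and the singletons.\<close>

lemma divergence_euler_lagrange:
  assumes \<phi>: "\<And>i. differential_function (\<phi> i)"
    and f: "f = (\<lambda>z. \<Sum>i\<in>UNIV. total_deriv i (\<phi> i) z)"
    and order: "\<And>\<alpha>. size \<alpha> > 1 \<Longrightarrow> partial (Dep \<alpha>) f = (\<lambda>z. 0)"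
  shows "partial (Dep {#}) f z = (\<Sum>i\<in>UNIV. total_deriv i (partial (Dep {#i#}) f) z)"
proof -
  have df: "differential_function f" unfolding f using \<phi> by simp
  have "\<forall>i. \<exists>F. finite F \<and> (\<forall>\<alpha>. \<alpha> \<notin> F \<longrightarrow> partial (Dep \<alpha>) (\<phi> i) = (\<lambda>z. 0))"
  proof
    fix i
    obtain F where "finite F" "\<And>\<alpha>. \<alpha> \<notin> F \<Longrightarrow> partial (Dep \<alpha>) (\<phi> i) = (\<lambda>z. 0)"
      using differential_function_support[OF \<phi>[of i]] by metis
    then show "\<exists>F. finite F \<and> (\<forall>\<alpha>. \<alpha> \<notin> F \<longrightarrow> partial (Dep \<alpha>) (\<phi> i) = (\<lambda>z. 0))"
      by blast
  qed
  from choice[OF this] obtain F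
    where F: "finite (F i)" "\<And>\<alpha>. \<alpha> \<notin> F i \<Longrightarrow> partial (Dep \<alpha>) (\<phi> i) = (\<lambda>z. 0)" for i
    by blast
  \<comment> \<open>The set holds the supports of all \<phi> and their shifts, so that the Euler
    operator kills each summand, and also the multi-indices of size at most one, which survive at
    the end.\<close>
  define A where "A = (\<Union>i. F i \<union> add_mset i ` F i) \<union> insert {#} (range (\<lambda>i. {#i#}))"
  have A: "finite A" unfolding A_def using F by auto
  have "euler_operator A (total_deriv i (\<phi> i)) z = 0" for i
    by (rule euler_operator_total_deriv[OF \<phi> F A]) (auto simp: A_def)
  then have "0 = euler_operator A f z"
    unfolding f using \<phi> by (subst euler_operator_sum) auto
  also have "\<dots> = (\<Sum>\<alpha>\<in>insert {#} (range (\<lambda>i. {#i#})).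
      (-1) ^ size \<alpha> * total_deriv_multi \<alpha> (partial (Dep \<alpha>) f) z)"
    unfolding euler_operator_def
  proof (rule sum.mono_neutral_right[OF A], goal_cases)
    case 2
    show ?case
    proof
      fix \<alpha> :: "3 multiset" assume "\<alpha> \<in> A - insert {#} (range (\<lambda>i. {#i#}))"
      then have "size \<alpha> \<noteq> 0" "size \<alpha> \<noteq> 1"
        using size_1_singleton_mset[of \<alpha>] by auto
      then have "size \<alpha> > 1" by linarith
      then show "(-1) ^ size \<alpha> * total_deriv_multi \<alpha> (partial (Dep \<alpha>) f) z = 0"
        by (simp add: order)
    qed
  qed (auto simp: A_def)
  also have "\<dots> = partial (Dep {#}) f z - (\<Sum>i\<in>UNIV. total_deriv i (partial (Dep {#i#}) f) z)"
    using df by (subst sum.insert) (auto simp: sum.reindex inj_def total_deriv_multi_single sum_negf)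
  finally show ?thesis by simp
qed

text \<open>In the Euler-Lagrange identity the left side has order at most one, whereas the total
  derivatives on the right produce second derivatives of \<open>u\<close>, with the Hessian entries
  as coefficients. These coefficients must therefore vanish.\<close>

lemma divergence_hessian_zero:
  assumes \<phi>: "\<And>i. differential_function (\<phi> i)"
    and f: "f = (\<lambda>z. \<Sum>i\<in>UNIV. total_deriv i (\<phi> i) z)"
    and order: "\<And>\<alpha>. size \<alpha> > 1 \<Longrightarrow> partial (Dep \<alpha>) f = (\<lambda>z. 0)"
  shows "partial (Dep {#k#}) (partial (Dep {#l#}) f) = (\<lambda>z. 0)"
proof
  fix z
  have df: "differential_function f" unfolding f using \<phi> by simp
  have EL: "partial (Dep {#}) f = (\<lambda>z. \<Sum>i\<in>UNIV. total_deriv i (partial (Dep {#i#}) f) z)"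
    by (rule ext, rule divergence_euler_lagrange[OF \<phi> f order])
  \<comment> \<open>Differentiating by \<open>u\<^sub>k\<^sub>l\<close> picks out the coefficient of \<open>u\<^sub>k\<^sub>l\<close>.\<close>
  have top: "partial (Dep {#k, l#}) (partial c f) = (\<lambda>z. 0)" for c
    using df by (simp add: partial_commute[of f "Dep {#k, l#}"] order)
  have "0 = partial (Dep {#k, l#}) (partial (Dep {#}) f) z" by (simp add: top)
  also have "\<dots> = (\<Sum>i\<in>UNIV. if i \<in># {#k, l#} then
      partial (Dep ({#k, l#} - {#i#})) (partial (Dep {#i#}) f) z else 0)"
    unfolding EL using df by (simp add: partial_Dep_total_deriv top)
  also have "\<dots> = (\<Sum>i\<in>{k, l}. partial (Dep ({#k, l#} - {#i#})) (partial (Dep {#i#}) f) z)"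
    by (rule sum.mono_neutral_cong_right) auto
  \<comment> \<open>For distinct \<open>k\<close> and \<open>l\<close>, the coordinate arises both
    from differentiating in direction \<open>k\<close> and from direction \<open>l\<close>, with
    equal contributions; for \<open>k = l\<close> it arises once.\<close>
  also have "\<dots> = (if k = l then 1 else 2) * partial (Dep {#k#}) (partial (Dep {#l#}) f) z"
  proof (cases "k = l")
    case False
    then show ?thesis
      using df partial_commute[of f "Dep {#k#}" "Dep {#l#}"] by (auto simp: add_mset_commute[of k l])
  qed simp
  finally show "partial (Dep {#k#}) (partial (Dep {#l#}) f) z = 0"
    by (simp split: if_splits)
qed

section \<open>The fields spanned by the generators\<close>

text \<open>Normal form with increasing indices, matching the index pairs in
  \<open>prolong2\<close>.\<close>

lemma Dep_sorted [simp]: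
  "{#2, 1#} = {#1, 2::3#}" "{#3, 1#} = {#1, 3::3#}" "{#3, 2#} = {#2, 3::3#}"
  by (simp_all add: add_mset_commute)

lemma pair_mset_eq_iff [simp]: "{#a, b#} = {#c, d#} \<longleftrightarrow> a = c \<and> b = d \<or> a = d \<and> b = c"
  by (auto simp: add_eq_conv_diff)

text \<open>The linear combination of \<open>vf_X\<close>, \<open>vf_Y\<close>, \<open>vf_R\<close>,
  \<open>vf_T\<close> with coefficients \<open>a\<close>, \<open>b\<close>, \<open>r\<close>,
  \<open>t\<close>.\<close>

definition vf_combination :: "real \<Rightarrow> real \<Rightarrow> real \<Rightarrow> real \<Rightarrow> vfield" where
  "vf_combination a b r t = vf_base (\<lambda>z. a + r * z (Indep 2)) (\<lambda>z. b - r * z (Indep 1))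
     (\<lambda>z. t - 2 * a * z (Indep 2) + 2 * b * z (Indep 1)) (\<lambda>z. 0)"

lemma vfield_eqI:
  assumes "xi S 1 = xi S' 1" "xi S 2 = xi S' 2" "xi S 3 = xi S' 3" "eta S = eta S'"
  shows "S = S'"
proof (rule vfield.expand)
  have "xi S i = xi S' i" for i using assms exhaust_3[of i] by auto
  then show "xi S = xi S' \<and> eta S = eta S'" using assms by auto
qed

lemma vf_combination_sel [simp]:
  "xi (vf_combination a b r t) 1 = (\<lambda>z. a + r * z (Indep 2))"
  "xi (vf_combination a b r t) 2 = (\<lambda>z. b - r * z (Indep 1))"
  "xi (vf_combination a b r t) 3 = (\<lambda>z. t - 2 * a * z (Indep 2) + 2 * b * z (Indep 1))"
  "eta (vf_combination a b r t) = (\<lambda>z. 0)"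
  by (simp_all add: vf_combination_def vf_base_def)

lemma vf_base_sel [simp]:
  "xi (vf_base f g h e) 1 = f" "xi (vf_base f g h e) 2 = g"
  "xi (vf_base f g h e) 3 = h" "eta (vf_base f g h e) = e"
  by (simp_all add: vf_base_def)

text \<open>The linear span is already closed under brackets: the bracket of \<open>vf_X\<close> and
  \<open>vf_Y\<close> is four times \<open>vf_T\<close>, \<open>vf_R\<close> rotates these two
  fields, and \<open>vf_T\<close> is central.\<close>

lemma vf_bracket_combination:
  "vf_bracket (vf_combination a b r t) (vf_combination a' b' r' t')
    = vf_combination (b * r' - b' * r) (a' * r - a * r') 0 (2 * (a * b' - a' * b) + 2 * (a * b' - a' * b))"
  by (rule vfield_eqI) (auto simp: vf_bracket_def vf_apply_def sum_3 algebra_simps)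

lemma generated_combination:
  "lie_algebra_generated {vf_T, vf_R, vf_X, vf_Y} = {vf_combination a b r t | a b r t. True}"
proof (intro equalityI subsetI)
  fix S assume "S \<in> lie_algebra_generated {vf_T, vf_R, vf_X, vf_Y}"
  then have "\<exists>a b r t. S = vf_combination a b r t"
  proof (induction rule: lie_algebra_generated.induct)
    case (generator S)
    have "vf_T = vf_combination 0 0 0 1" "vf_R = vf_combination 0 0 1 0"
      "vf_X = vf_combination 1 0 0 0" "vf_Y = vf_combination 0 1 0 0"
      by (auto intro!: vfield_eqI simp: vf_T_def vf_R_def vf_X_def vf_Y_def)
    then show ?case using generator by blast
  next
    case zero
    have "vf_zero = vf_combination 0 0 0 0"
      by (auto intro!: vfield_eqI simp: vf_zero_def)
    then show ?case by blast
  next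
    case (add S S')
    then obtain a b r t a' b' r' t'
      where "S = vf_combination a b r t" "S' = vf_combination a' b' r' t'" by blast
    then have "vf_add S S' = vf_combination (a + a') (b + b') (r + r') (t + t')"
      by (auto intro!: vfield_eqI simp: vf_add_def algebra_simps)
    then show ?case by blast
  next
    case (scale S k)
    then obtain a b r t where "S = vf_combination a b r t" by blast
    then have "vf_scale k S = vf_combination (k * a) (k * b) (k * r) (k * t)"
      by (auto intro!: vfield_eqI simp: vf_scale_def algebra_simps)
    then show ?case by blast
  next
    case (bracket S S')
    then show ?case using vf_bracket_combination by metis
  qed
  then show "S \<in> {vf_combination a b r t | a b r t. True}" by blast
next
  fix S assume "S \<in> {vf_combination a b r t | a b r t. True}"
  then obtain a b r t where "S = vf_combination a b r t" by blast
  then have "S = vf_add (vf_add (vf_scale a vf_X) (vf_scale b vf_Y))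
      (vf_add (vf_scale r vf_R) (vf_scale t vf_T))"
    by (auto intro!: vfield_eqI simp: vf_T_def vf_R_def vf_X_def vf_Y_def vf_add_def vf_scale_def algebra_simps)
  then show "S \<in> lie_algebra_generated {vf_T, vf_R, vf_X, vf_Y}"
    by (simp add: lie_algebra_generated.intros)
qed

section \<open>The combinations are Noether symmetries\<close>

lemma eta1_combination:
  "eta1 (vf_combination a b r t) 1 = (\<lambda>z. r * z (Dep {#2#}) - 2 * b * z (Dep {#3#}))"
  "eta1 (vf_combination a b r t) 2 = (\<lambda>z. 2 * a * z (Dep {#3#}) - r * z (Dep {#1#}))"
  "eta1 (vf_combination a b r t) 3 = (\<lambda>z. 0)"
  by (auto simp: eta1_def fun_eq_iff sum_3 total_deriv_Indep)

text \<open>Squares are written as products so that the product rule for \<open>partial\<close>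
  applies.\<close>

lemma lagrangian_eq:
  "lagrangian = (\<lambda>z. 1/2 * (z (Dep {#1#}) * z (Dep {#1#})) + 1/2 * (z (Dep {#2#}) * z (Dep {#2#}))
     + 2 * (z (Indep 1) * z (Indep 1) + z (Indep 2) * z (Indep 2)) * (z (Dep {#3#}) * z (Dep {#3#}))
     + 2 * z (Indep 2) * z (Dep {#1#}) * z (Dep {#3#}) - 2 * z (Indep 1) * z (Dep {#2#}) * z (Dep {#3#})
     - exp (z (Dep {#})))"
  by (simp add: lagrangian_def Let_def power2_eq_square fun_eq_iff)

lemma equation_lhs_eq:
  "equation_lhs = (\<lambda>z. z (Dep {#1, 1#}) + z (Dep {#2, 2#})
     + 4 * (z (Indep 1) * z (Indep 1) + z (Indep 2) * z (Indep 2)) * z (Dep {#3, 3#})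
     + 4 * z (Indep 2) * z (Dep {#1, 3#}) - 4 * z (Indep 1) * z (Dep {#2, 3#}) + exp (z (Dep {#})))"
  by (simp add: equation_lhs_def kohn_laplace_def Let_def power2_eq_square fun_eq_iff)

lemma base_function_const [simp]: "base_function (\<lambda>z. k)"
  by (simp add: base_function_def depends_only_on_def)

lemma base_function_Indep [simp]: "base_function (\<lambda>z. z (Indep i))"
  by (simp add: base_function_def depends_only_on_def)

lemma base_function_exp [simp]: "base_function (\<lambda>z. exp (z (Dep {#})))"
  by (simp add: base_function_def depends_only_on_def)

lemma base_function_add [simp]:
  "base_function f \<Longrightarrow> base_function g \<Longrightarrow> base_function (\<lambda>z. f z + g z)"
  unfolding base_function_def depends_only_on_def by (metis (no_types, lifting) smooth_add)

lemma base_function_diff [simp]: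
  "base_function f \<Longrightarrow> base_function g \<Longrightarrow> base_function (\<lambda>z. f z - g z)"
  unfolding base_function_def depends_only_on_def by (metis (no_types, lifting) smooth_diff)

lemma base_function_mult [simp]:
  "base_function f \<Longrightarrow> base_function g \<Longrightarrow> base_function (\<lambda>z. f z * g z)"
  unfolding base_function_def depends_only_on_def by (metis (no_types, lifting) smooth_mult)

lemma base_function_partial [simp]: "base_function f \<Longrightarrow> base_function (partial c f)"
  unfolding base_function_def by (simp add: depends_only_on_partial smooth_partial)

text \<open>The prolonged fields annihilate the Lagrangian and the left side of the equation on the
  whole jet space. As they are also divergence free, the zero vector serves as \<phi>.\<close>

lemma noether_combination: "noether_symmetry (vf_combination a b r t)"
proof -
  let ?S = "vf_combination a b r t"
  have "base_function (xi ?S i)" for i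
    using exhaust_3[of i] by auto
  then have "point_vfield ?S" by (simp add: point_vfield_def)
  moreover have "prolong2 ?S equation_lhs z = 0" for z
    by (simp add: prolong2_def prolong1_def vf_apply_def eta2_def eta1_combination sum_3
        total_deriv_Indep equation_lhs_eq algebra_simps)
  moreover have "prolong1 ?S lagrangian z + lagrangian z * (\<Sum>i\<in>UNIV. total_deriv i (xi ?S i) z) = 0" for z
    by (simp add: prolong1_def vf_apply_def eta1_combination sum_3
        total_deriv_Indep lagrangian_eq algebra_simps)
  ultimately show ?thesis
    unfolding noether_symmetry_def lie_point_symmetry_def
    by (intro conjI exI[of _ "\<lambda>i z. 0"]) auto
qed

section \<open>Determining equations\<close>

definition noether_density :: "vfield \<Rightarrow> jet \<Rightarrow> real" where
  "noether_density S z =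
     prolong1 S lagrangian z + lagrangian z * (\<Sum>i\<in>UNIV. total_deriv i (xi S i) z)"

text \<open>Only explicit derivatives are taken. The remaining terms of the total divergence, which
  contain the \<open>u\<close>-derivatives of \<xi>, enter \<open>linear_part\<close> and
  \<open>cubic_part\<close>.\<close>

definition divergence :: "vfield \<Rightarrow> jet \<Rightarrow> real" where
  "divergence S z = (\<Sum>i\<in>UNIV. partial (Indep i) (xi S i) z)"

definition horizontal_X :: "(jet \<Rightarrow> real) \<Rightarrow> jet \<Rightarrow> real" where
  "horizontal_X f z = partial (Indep 1) f z + 2 * z (Indep 2) * partial (Indep 3) f z"

definition horizontal_Y :: "(jet \<Rightarrow> real) \<Rightarrow> jet \<Rightarrow> real" where
  "horizontal_Y f z = partial (Indep 2) f z - 2 * z (Indep 1) * partial (Indep 3) f z"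

text \<open>Here and in the next two definitions \<open>p1\<close>, \<open>p2\<close>,
  \<open>p3\<close> stand for the first derivatives of \<open>u\<close>, kept as separate arguments
  so that they can be scaled at a fixed base point.\<close>

definition linear_part :: "vfield \<Rightarrow> jet \<Rightarrow> real \<Rightarrow> real \<Rightarrow> real \<Rightarrow> real" where
  "linear_part S z p1 p2 p3 =
     horizontal_X (eta S) z * p1 + horizontal_Y (eta S) z * p2
     + (2 * z (Indep 2) * horizontal_X (eta S) z - 2 * z (Indep 1) * horizontal_Y (eta S) z) * p3
     - exp (z (Dep {#})) * (partial (Dep {#}) (xi S 1) z * p1 + partial (Dep {#}) (xi S 2) z * p2
        + partial (Dep {#}) (xi S 3) z * p3)"

text \<open>\<open>P\<close> and \<open>Q\<close> are the horizontal derivatives of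
  \<open>u\<close>. The terms with \<open>2 * xi S 2 z * p3\<close> and
  \<open>2 * xi S 1 z * p3\<close> come from the action of \<open>S\<close> on the coefficients
  \<open>2y\<close> and \<open>-2x\<close> of the horizontal fields.\<close>

definition quadratic_part :: "vfield \<Rightarrow> jet \<Rightarrow> real \<Rightarrow> real \<Rightarrow> real \<Rightarrow> real" where
  "quadratic_part S z p1 p2 p3 =
     (let P = p1 + 2 * z (Indep 2) * p3; Q = p2 - 2 * z (Indep 1) * p3 in
       P * (2 * xi S 2 z * p3 - (horizontal_X (xi S 1) z * p1 + horizontal_X (xi S 2) z * p2
              + horizontal_X (xi S 3) z * p3))
       - Q * (2 * xi S 1 z * p3 + (horizontal_Y (xi S 1) z * p1 + horizontal_Y (xi S 2) z * p2
              + horizontal_Y (xi S 3) z * p3))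
       + (partial (Dep {#}) (eta S) z + divergence S z / 2) * (P * P + Q * Q))"

definition cubic_part :: "vfield \<Rightarrow> jet \<Rightarrow> real \<Rightarrow> real \<Rightarrow> real \<Rightarrow> real" where
  "cubic_part S z p1 p2 p3 =
     (let P = p1 + 2 * z (Indep 2) * p3; Q = p2 - 2 * z (Indep 1) * p3 in
       - (P * P + Q * Q) / 2 * (partial (Dep {#}) (xi S 1) z * p1 + partial (Dep {#}) (xi S 2) z * p2
        + partial (Dep {#}) (xi S 3) z * p3))"

definition constant_part :: "vfield \<Rightarrow> jet \<Rightarrow> real" where
  "constant_part S z = - (exp (z (Dep {#})) * (eta S z + divergence S z))"

section \<open>Expansion of the density by degree in the first derivatives\<close>

lemma point_vfield_base:
  assumes "point_vfield S"
  shows "base_function (xi S i)" "base_function (eta S)"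
  using assms by (auto simp: point_vfield_def)

lemma noether_density_eq:
  assumes "point_vfield S"
  shows "noether_density S z = constant_part S z
    + linear_part S z (z (Dep {#1#})) (z (Dep {#2#})) (z (Dep {#3#}))
    + quadratic_part S z (z (Dep {#1#})) (z (Dep {#2#})) (z (Dep {#3#}))
    + cubic_part S z (z (Dep {#1#})) (z (Dep {#2#})) (z (Dep {#3#}))"
  using point_vfield_base[OF assms]
  unfolding noether_density_def constant_part_def linear_part_def quadratic_part_def cubic_part_def
    Let_def horizontal_X_def horizontal_Y_def divergence_def prolong1_def vf_apply_def eta1_def sum_3
  by (simp add: total_deriv_base lagrangian_eq algebra_simps add_divide_distrib diff_divide_distrib)

lemma linear_part_scale: "linear_part S z (s * p1) (s * p2) (s * p3) = s * linear_part S z p1 p2 p3"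
  by (simp add: linear_part_def algebra_simps)

lemma quadratic_part_scale:
  "quadratic_part S z (s * p1) (s * p2) (s * p3) = s * s * quadratic_part S z p1 p2 p3"
  by (simp add: quadratic_part_def Let_def algebra_simps)

lemma cubic_part_scale:
  "cubic_part S z (s * p1) (s * p2) (s * p3) = s * s * s * cubic_part S z p1 p2 p3"
  by (simp add: cubic_part_def Let_def algebra_simps add_divide_distrib diff_divide_distrib)

text \<open>Movement in the fibre over a fixed base point: coefficients that are base functions stay
  constant.\<close>

definition set_first_derivs :: "jet \<Rightarrow> real \<Rightarrow> real \<Rightarrow> real \<Rightarrow> jet" where
  "set_first_derivs z p1 p2 p3 = z(Dep {#1#} := p1, Dep {#2#} := p2, Dep {#3#} := p3)"

lemma set_first_derivs_apply [simp]:
  "set_first_derivs z p1 p2 p3 (Indep i) = z (Indep i)"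
  "set_first_derivs z p1 p2 p3 (Dep {#}) = z (Dep {#})"
  "set_first_derivs z p1 p2 p3 (Dep {#1#}) = p1"
  "set_first_derivs z p1 p2 p3 (Dep {#2#}) = p2"
  "set_first_derivs z p1 p2 p3 (Dep {#3#}) = p3"
  by (auto simp: set_first_derivs_def)

lemma base_function_cong:
  assumes "base_function f" "\<And>i. z (Indep i) = w (Indep i)" "z (Dep {#}) = w (Dep {#})"
  shows "f z = f w"
  using assms unfolding base_function_def by (auto elim!: depends_only_onD)

lemma set_first_derivs_base:
  assumes "base_function f"
  shows "f (set_first_derivs z p1 p2 p3) = f z"
  by (rule base_function_cong[OF assms]) simp_all

lemma noether_density_set_first_derivs:
  assumes "point_vfield S"
  shows "noether_density S (set_first_derivs z p1 p2 p3) = constant_part S z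
    + linear_part S z p1 p2 p3 + quadratic_part S z p1 p2 p3 + cubic_part S z p1 p2 p3"
proof -
  note base = point_vfield_base[OF assms]
  show ?thesis
    unfolding noether_density_eq[OF assms] using base
    by (simp add: constant_part_def linear_part_def quadratic_part_def cubic_part_def Let_def
        horizontal_X_def horizontal_Y_def divergence_def set_first_derivs_base)
qed

lemma noether_density_partial_zero:
  assumes "point_vfield S" "size \<alpha> > 1"
  shows "partial (Dep \<alpha>) (noether_density S) = (\<lambda>z. 0)"
proof (rule partial_eq_zero)
  let ?C = "range Indep \<union> {Dep \<beta> | \<beta>. size \<beta> \<le> 1}"
  show "depends_only_on ?C (noether_density S)"
    unfolding depends_only_on_def
  proof (intro allI impI)
    fix z w :: jet assume zw: "\<forall>c\<in>?C. z c = w c"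
    have c: "z (Indep i) = w (Indep i)" "z (Dep {#}) = w (Dep {#})" "z (Dep {#i#}) = w (Dep {#i#})" for i
      using zw by auto
    have f: "f z = f w" if "base_function f" for f
      by (rule base_function_cong[OF that]) (use c in auto)
    show "noether_density S z = noether_density S w"
      unfolding noether_density_eq[OF assms(1)] using point_vfield_base[OF assms(1)]
      by (simp add: constant_part_def linear_part_def quadratic_part_def cubic_part_def Let_def
        horizontal_X_def horizontal_Y_def divergence_def c f)
  qed
qed (use assms(2) in auto)

section \<open>Functions that are affine in the first derivatives\<close>

lemma affine_in_coordinate:
  assumes f: "smooth_jet_fun f" and "partial c (partial c f) = (\<lambda>z. 0)"
  shows "f (z(c := s)) = f (z(c := 0)) + s * partial c f z"
proof -
  have "partial c f (z(c := t)) = partial c f z" for t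
    by (rule partial_zero_imp_upd_eq) (use assms in auto)
  then have "((\<lambda>s. f (z(c := s)) - s * partial c f z) has_real_derivative 0) (at t)" for t
    using smooth_has_partial[OF f, of z c t] by (auto intro!: derivative_eq_intros)
  then have "f (z(c := s)) - s * partial c f z = f (z(c := 0)) - 0 * partial c f z"
    by (intro DERIV_isconst_all[where f = "\<lambda>s. f (z(c := s)) - s * partial c f z"]) auto
  then show ?thesis by simp
qed

text \<open>With zero Hessian, each first-order partial is constant along the fibre, so the three
  coordinates can be changed one after another with the same slopes.\<close>

lemma affine_in_first_derivs:
  assumes f: "smooth_jet_fun f"
    and hess: "\<And>k l. partial (Dep {#k#}) (partial (Dep {#l#}) f) = (\<lambda>z. 0)"
  shows "f (set_first_derivs z p1 p2 p3) = f (set_first_derivs z 0 0 0)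
    + p1 * partial (Dep {#1#}) f z + p2 * partial (Dep {#2#}) f z + p3 * partial (Dep {#3#}) f z"
proof -
  have inv: "partial (Dep {#l#}) f (w(Dep {#k#} := s)) = partial (Dep {#l#}) f w" for k l w s
    by (rule partial_zero_imp_upd_eq) (use f hess in auto)
  have aff: "f (w(Dep {#l#} := s)) = f (w(Dep {#l#} := 0)) + s * partial (Dep {#l#}) f w" for w l s
    by (rule affine_in_coordinate[OF f hess])
  have "f (set_first_derivs z p1 p2 p3) = f (set_first_derivs z p1 p2 0) + p3 * partial (Dep {#3#}) f z"
    unfolding set_first_derivs_def by (subst aff) (simp only: inv)
  moreover have "f (set_first_derivs z p1 p2 0) = f (set_first_derivs z p1 0 0) + p2 * partial (Dep {#2#}) f z"
    using aff[of "z(Dep {#1#} := p1, Dep {#3#} := 0)" 2 p2]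
    unfolding set_first_derivs_def by (simp only: inv) (simp add: fun_upd_twist)
  moreover have "f (set_first_derivs z p1 0 0) = f (set_first_derivs z 0 0 0) + p1 * partial (Dep {#1#}) f z"
    using aff[of "z(Dep {#2#} := 0, Dep {#3#} := 0)" 1 p1]
    unfolding set_first_derivs_def by (simp only: inv) (simp add: fun_upd_twist)
  ultimately show ?thesis by simp
qed

text \<open>Four sample points determine a polynomial of degree at most three.\<close>

lemma polynomial_equals_affine:
  fixes c0 c1 c2 c3 d0 d1 :: real
  assumes "\<And>s. c0 + s * c1 + s * s * c2 + s * s * s * c3 = d0 + s * d1"
  shows "c1 = d1" "c2 = 0" "c3 = 0"
  using assms[of 0] assms[of 1] assms[of "-1"] assms[of 2] by auto

section \<open>Determining equations of a fixed Noether symmetry\<close>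

locale noether_field =
  fixes S :: vfield
  assumes noether: "noether_symmetry S"
begin

lemma point: "point_vfield S"
  using noether by (simp add: noether_symmetry_def lie_point_symmetry_def)

lemma base [simp]: "base_function (xi S i)" "base_function (eta S)"
  using point_vfield_base[OF point] by auto

lemma density_divergence:
  obtains \<phi> :: "3 \<Rightarrow> jet \<Rightarrow> real" where "\<And>i. differential_function (\<phi> i)"
    "noether_density S = (\<lambda>z. \<Sum>i\<in>UNIV. total_deriv i (\<phi> i) z)"
  using noether unfolding noether_symmetry_def noether_density_def by blast

lemma density_smooth: "differential_function (noether_density S)"
  by (rule density_divergence) simp

lemma density_euler_lagrange:
  "partial (Dep {#}) (noether_density S) z
    = (\<Sum>i\<in>UNIV. total_deriv i (partial (Dep {#i#}) (noether_density S)) z)"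
  by (rule density_divergence)
     (erule divergence_euler_lagrange, assumption, rule noether_density_partial_zero[OF point])

lemma density_hessian: "partial (Dep {#k#}) (partial (Dep {#l#}) (noether_density S)) = (\<lambda>z. 0)"
  by (rule density_divergence)
     (erule divergence_hessian_zero, assumption, rule noether_density_partial_zero[OF point])

text \<open>Along the ray with first derivatives \<open>s * p1\<close>, \<open>s * p2\<close>,
  \<open>s * p3\<close> the density is a cubic polynomial in \<open>s\<close> whose coefficients are
  the four parts. The vanishing Hessian makes it affine in \<open>s\<close>.\<close>

lemma density_parts:
  "linear_part S z p1 p2 p3 = p1 * partial (Dep {#1#}) (noether_density S) z
     + p2 * partial (Dep {#2#}) (noether_density S) z + p3 * partial (Dep {#3#}) (noether_density S) z"
  "quadratic_part S z p1 p2 p3 = 0"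
  "cubic_part S z p1 p2 p3 = 0"
proof -
  have "constant_part S z + s * linear_part S z p1 p2 p3
      + s * s * quadratic_part S z p1 p2 p3 + s * s * s * cubic_part S z p1 p2 p3
    = noether_density S (set_first_derivs z 0 0 0)
      + s * (p1 * partial (Dep {#1#}) (noether_density S) z
     + p2 * partial (Dep {#2#}) (noether_density S) z + p3 * partial (Dep {#3#}) (noether_density S) z)" for s
    using affine_in_first_derivs[OF differential_function_smooth[OF density_smooth] density_hessian,
        of z "s * p1" "s * p2" "s * p3"]
    unfolding noether_density_set_first_derivs[OF point, of z "s * p1"]
      linear_part_scale quadratic_part_scale cubic_part_scale
    by (simp add: algebra_simps)
  note polynomial_equals_affine[OF this]
  then show "linear_part S z p1 p2 p3 = p1 * partial (Dep {#1#}) (noether_density S) z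
     + p2 * partial (Dep {#2#}) (noether_density S) z + p3 * partial (Dep {#3#}) (noether_density S) z"
    "quadratic_part S z p1 p2 p3 = 0" "cubic_part S z p1 p2 p3 = 0"
    by auto
qed

lemma xi_u: "partial (Dep {#}) (xi S i) = (\<lambda>z. 0)"
proof
  fix z :: jet
  have "partial (Dep {#}) (xi S 1) z = 0" "partial (Dep {#}) (xi S 2) z = 0"
    using density_parts(3)[of z 1 0 0] density_parts(3)[of z 0 1 0]
    by (auto simp: cubic_part_def)
  \<comment> \<open>The vector chosen has \<open>P = 1\<close>, \<open>Q = 0\<close> and third
    component 1, so the factor \<open>P * P + Q * Q\<close> does not vanish.\<close>
  moreover from this have "partial (Dep {#}) (xi S 3) z = 0"
    using density_parts(3)[of z "1 - 2 * z (Indep 2)" "2 * z (Indep 1)" 1]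
    by (auto simp: cubic_part_def)
  ultimately show "partial (Dep {#}) (xi S i) z = 0"
    using exhaust_3[of i] by auto
qed

text \<open>In the fibre coordinates \<open>P\<close>, \<open>Q\<close>, \<open>p3\<close>, these
  are the coefficients of the squares of \<open>P\<close> and \<open>Q\<close> and of the products
  \<open>P Q\<close>, \<open>P p3\<close>, \<open>Q p3\<close>. The last two equations say that the
  flow preserves the horizontal distribution.\<close>

lemma conformal:
  "horizontal_X (xi S 1) z = partial (Dep {#}) (eta S) z + divergence S z / 2"
  "horizontal_Y (xi S 2) z = partial (Dep {#}) (eta S) z + divergence S z / 2"
  "horizontal_X (xi S 2) z + horizontal_Y (xi S 1) z = 0"
  "horizontal_X (xi S 3) z - 2 * z (Indep 2) * horizontal_X (xi S 1) z
     + 2 * z (Indep 1) * horizontal_X (xi S 2) z = 2 * xi S 2 z"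
  "horizontal_Y (xi S 3) z - 2 * z (Indep 2) * horizontal_Y (xi S 1) z
     + 2 * z (Indep 1) * horizontal_Y (xi S 2) z = - 2 * xi S 1 z"
proof -
  \<comment> \<open>The vectors below are those with \<open>(P, Q, p3)\<close> equal to a unit vector or a sum of two of them.\<close>
  note q = density_parts(2)[of z]
  let ?x = "z (Indep 1)" and ?y = "z (Indep 2)"
  show X1: "horizontal_X (xi S 1) z = partial (Dep {#}) (eta S) z + divergence S z / 2"
    using q[of 1 0 0] by (simp add: quadratic_part_def)
  show Y2: "horizontal_Y (xi S 2) z = partial (Dep {#}) (eta S) z + divergence S z / 2"
    using q[of 0 1 0] by (simp add: quadratic_part_def)
  show "horizontal_X (xi S 2) z + horizontal_Y (xi S 1) z = 0"
    using q[of 1 1 0] X1 Y2 by (simp add: quadratic_part_def)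
  show "horizontal_X (xi S 3) z - 2 * z (Indep 2) * horizontal_X (xi S 1) z
     + 2 * z (Indep 1) * horizontal_X (xi S 2) z = 2 * xi S 2 z"
    using q[of "1 - 2 * ?y" "2 * ?x" 1] X1 by (simp add: quadratic_part_def algebra_simps)
  show "horizontal_Y (xi S 3) z - 2 * z (Indep 2) * horizontal_Y (xi S 1) z
     + 2 * z (Indep 1) * horizontal_Y (xi S 2) z = - 2 * xi S 1 z"
    using q[of "- 2 * ?y" "1 + 2 * ?x" 1] Y2 by (simp add: quadratic_part_def algebra_simps)
qed

text \<open>As \<xi> does not depend on \<open>u\<close>, the linear part is \<open>P\<close> times
  the \<open>X\<close>-derivative of \<eta> plus \<open>Q\<close> times its
  \<open>Y\<close>-derivative.\<close>

lemma density_first_partials: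
  "partial (Dep {#1#}) (noether_density S) = horizontal_X (eta S)"
  "partial (Dep {#2#}) (noether_density S) = horizontal_Y (eta S)"
  "partial (Dep {#3#}) (noether_density S) =
     (\<lambda>z. 2 * z (Indep 2) * horizontal_X (eta S) z - 2 * z (Indep 1) * horizontal_Y (eta S) z)"
  using density_parts(1)[of _ 1 0 0] density_parts(1)[of _ 0 1 0] density_parts(1)[of _ 0 0 1]
  by (auto simp: linear_part_def xi_u)

end

section \<open>Integration of the determining equations\<close>

lemma base_function_minus [simp]: "base_function f \<Longrightarrow> base_function (\<lambda>z. - f z)"
  using base_function_mult[OF base_function_const[of "-1"]] by simp

lemma base_function_horizontal [simp]:
  assumes "base_function f"
  shows "base_function (horizontal_X f)" "base_function (horizontal_Y f)"
proof -
  have "base_function (\<lambda>z. partial (Indep 1) f z + 2 * z (Indep 2) * partial (Indep 3) f z)"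
    "base_function (\<lambda>z. partial (Indep 2) f z - 2 * z (Indep 1) * partial (Indep 3) f z)"
    using assms by simp_all
  then show "base_function (horizontal_X f)" "base_function (horizontal_Y f)"
    by (simp_all add: horizontal_X_def[abs_def] horizontal_Y_def[abs_def])
qed

lemma base_function_divergence:
  assumes "point_vfield S"
  shows "base_function (divergence S)"
proof -
  have "base_function (\<lambda>z. partial (Indep 1) (xi S 1) z + partial (Indep 2) (xi S 2) z
      + partial (Indep 3) (xi S 3) z)"
    using point_vfield_base[OF assms] by simp
  then show ?thesis by (simp add: divergence_def[abs_def] sum_3)
qed

lemma partial_u_horizontal:
  assumes "smooth_jet_fun f"
  shows "partial (Dep {#}) (horizontal_X f) = horizontal_X (partial (Dep {#}) f)"
    "partial (Dep {#}) (horizontal_Y f) = horizontal_Y (partial (Dep {#}) f)"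
  using assms partial_commute[OF assms, of "Dep {#}"]
  by (simp_all add: horizontal_X_def[abs_def] horizontal_Y_def[abs_def])

text \<open>The vertical direction is a bracket of horizontal ones; this is how horizontal equations
  yield information on \<open>t\<close>-derivatives.\<close>

lemma horizontal_commutator:
  assumes "smooth_jet_fun f"
  shows "horizontal_X (horizontal_Y f) z - horizontal_Y (horizontal_X f) z = - 4 * partial (Indep 3) f z"
  using assms partial_commute[OF assms, of "Indep 2" "Indep 1"]
    partial_commute[OF assms, of "Indep 3" "Indep 1"] partial_commute[OF assms, of "Indep 3" "Indep 2"]
  by (simp add: horizontal_X_def[abs_def] horizontal_Y_def[abs_def] algebra_simps)

lemma horizontal_zero [simp]: "horizontal_X (\<lambda>z. 0) = (\<lambda>z. 0)" "horizontal_Y (\<lambda>z. 0) = (\<lambda>z. 0)"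
  by (auto simp: horizontal_X_def horizontal_Y_def)

lemma base_function_constant:
  assumes f: "base_function f"
    and "\<And>i. partial (Indep i) f = (\<lambda>z. 0)" "partial (Dep {#}) f = (\<lambda>z. 0)"
  obtains k where "f = (\<lambda>z. k)"
proof
  show "f = (\<lambda>z. f (\<lambda>c. 0))"
  proof
    fix z :: jet
    let ?w = "z(Indep 1 := 0, Indep 2 := 0, Indep 3 := 0, Dep {#} := 0)"
    have "f z = f ?w"
      using assms by (simp add: partial_zero_imp_upd_eq del: fun_upd_apply)
    also have "\<dots> = f (\<lambda>c. 0)"
    proof (rule base_function_cong[OF f])
      show "?w (Indep i) = 0" for i using exhaust_3[of i] by auto
    qed simp
    finally show "f z = f (\<lambda>c. 0)" .
  qed
qed

section \<open>The component \<eta> and the conformal factor\<close>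

context noether_field
begin

lemma divergence_base [simp]: "base_function (divergence S)"
  by (rule base_function_divergence[OF point])

lemma divergence_u: "partial (Dep {#}) (divergence S) = (\<lambda>z. 0)"
proof -
  have "partial (Dep {#}) (partial (Indep i) (xi S j)) = (\<lambda>z. 0)" for i j
    by (simp add: partial_commute[of _ "Dep {#}"] xi_u)
  then show ?thesis by (simp add: divergence_def[abs_def])
qed

text \<open>This is the Euler-Lagrange identity at a jet with zero first derivatives, where total
  derivatives of base functions become explicit ones.\<close>

lemma divergence_condition:
  "partial (Dep {#}) (constant_part S)
     = (\<lambda>z. horizontal_X (horizontal_X (eta S)) z + horizontal_Y (horizontal_Y (eta S)) z)"
proof
  fix z
  let ?w = "set_first_derivs z 0 0 0"
  have const: "base_function (constant_part S)"
    by (simp add: constant_part_def[abs_def])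
  \<comment> \<open>The line in direction \<open>u\<close> keeps the first derivatives zero, so the
    other parts vanish along all of it.\<close>
  have "noether_density S (?w(Dep {#} := s)) = constant_part S (?w(Dep {#} := s))" for s
    by (simp add: noether_density_eq[OF point] linear_part_def quadratic_part_def cubic_part_def)
  then have "partial (Dep {#}) (constant_part S) ?w = partial (Dep {#}) (noether_density S) ?w"
    by (simp add: partial_def)
  also have "\<dots> = (\<Sum>i\<in>UNIV. total_deriv i (partial (Dep {#i#}) (noether_density S)) ?w)"
    by (rule density_euler_lagrange)
  also have "\<dots> = horizontal_X (horizontal_X (eta S)) ?w + horizontal_Y (horizontal_Y (eta S)) ?w"
    by (simp add: sum_3 density_first_partials total_deriv_base
        horizontal_X_def[of "horizontal_X _"] horizontal_Y_def[of "horizontal_Y _"])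
  \<comment> \<open>Both sides are base functions and take the same values at \<open>?w\<close> and
    \<open>z\<close>.\<close>
  finally show "partial (Dep {#}) (constant_part S) z
     = horizontal_X (horizontal_X (eta S)) z + horizontal_Y (horizontal_Y (eta S)) z"
    using const by (simp add: set_first_derivs_base)
qed

text \<open>The conformal equations express the \<open>u\<close>-derivative of \<eta> through \<xi>,
  which does not depend on \<open>u\<close>.\<close>

lemma eta_uu: "partial (Dep {#}) (partial (Dep {#}) (eta S)) = (\<lambda>z. 0)"
proof -
  have "partial (Dep {#}) (eta S) = (\<lambda>z. horizontal_X (xi S 1) z - divergence S z / 2)"
    using conformal(1) by auto
  then show ?thesis
    by (simp add: partial_u_horizontal xi_u divergence_u)
qed

lemma eta_u: "partial (Dep {#}) (eta S) = (\<lambda>z. 0)"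
  and eta_divergence: "eta S z = - divergence S z"
proof -
  let ?u = "partial (Dep {#})"
  \<comment> \<open>The first \<open>u\<close>-derivative is affine in \<open>u\<close> because
    \<eta> is; two more derivatives remove it.\<close>
  have "?u (?u (?u (constant_part S))) = (\<lambda>z. 0)"
    by (simp add: divergence_condition partial_u_horizontal eta_uu)
  \<comment> \<open>For \<eta> affine in \<open>u\<close>, three derivatives of the product with the
    exponential leave three times the slope of \<eta>.\<close>
  then have "3 * ?u (eta S) z + (eta S z + divergence S z) = 0" for z
    by (simp add: constant_part_def[abs_def] divergence_u eta_uu fun_eq_iff flip: distrib_left)
  then have V: "eta S z + divergence S z = - 3 * ?u (eta S) z" for z
    by (simp add: eq_neg_iff_add_eq_0 add.commute)
  then have "?u (\<lambda>z. eta S z + divergence S z) = ?u (\<lambda>z. - 3 * ?u (eta S) z)"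
    by simp
  then show u: "?u (eta S) = (\<lambda>z. 0)"
    by (simp add: divergence_u eta_uu)
  show "eta S z = - divergence S z"
    using V[of z] by (simp add: u)
qed

text \<open>The contact form \<open>dt - 2y dx + 2x dy\<close>, which annihilates the horizontal fields, evaluated on \<open>S\<close>.\<close>

definition hamiltonian :: "jet \<Rightarrow> real" where
  "hamiltonian z = xi S 3 z - 2 * z (Indep 2) * xi S 1 z + 2 * z (Indep 1) * xi S 2 z"

lemma hamiltonian_base [simp]: "base_function hamiltonian"
  by (simp add: hamiltonian_def[abs_def])

text \<open>The contact equations contribute half of each right side; differentiating the
  coefficients \<open>2x\<close> and \<open>-2y\<close> contributes the other half.\<close>

lemma hamiltonian_horizontal:
  "horizontal_X hamiltonian = (\<lambda>z. 4 * xi S 2 z)"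
  "horizontal_Y hamiltonian = (\<lambda>z. - 4 * xi S 1 z)"
  using conformal(4,5)
  by (auto simp: fun_eq_iff hamiltonian_def[abs_def] horizontal_X_def horizontal_Y_def algebra_simps)

lemma conformal_factor:
  "partial (Indep 3) hamiltonian = (\<lambda>z. 0)"
  "divergence S z = 0" "horizontal_X (xi S 1) z = 0" "horizontal_Y (xi S 2) z = 0"
proof -
  have XY: "horizontal_X (xi S 1) z = divergence S z / 2" "horizontal_Y (xi S 2) z = divergence S z / 2" for z
    using conformal(1,2)[of z] by (simp_all add: eta_u)
  have h3: "partial (Indep 3) hamiltonian z = divergence S z" for z
  proof -
    \<comment> \<open>The commutator applied to the Hamiltonian gives its
      \<open>t\<close>-derivative as the sum of the two horizontal derivatives, each half the
      divergence.\<close>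
    have "horizontal_X (\<lambda>z. - 4 * xi S 1 z) z - horizontal_Y (\<lambda>z. 4 * xi S 2 z) z
        = - 4 * partial (Indep 3) hamiltonian z"
      using horizontal_commutator[of hamiltonian z] by (simp add: hamiltonian_horizontal)
    moreover have "horizontal_X (\<lambda>z. - 4 * xi S 1 z) z = - 4 * horizontal_X (xi S 1) z"
      by (simp add: horizontal_X_def algebra_simps)
    moreover have "horizontal_Y (\<lambda>z. 4 * xi S 2 z) z = 4 * horizontal_Y (xi S 2) z"
      by (simp add: horizontal_Y_def algebra_simps)
    ultimately show ?thesis
      using XY[of z] by linarith
  qed
  \<comment> \<open>The divergence is the sum of the two horizontal derivatives and the
    \<open>t\<close>-derivative of the Hamiltonian, hence twice itself.\<close>
  have D: "divergence S z = 0" for z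
    using h3[of z] XY[of z]
    by (simp add: hamiltonian_def[abs_def] horizontal_X_def horizontal_Y_def divergence_def[of S z] sum_3)
  then show "partial (Indep 3) hamiltonian = (\<lambda>z. 0)"
    "divergence S z = 0" "horizontal_X (xi S 1) z = 0" "horizontal_Y (xi S 2) z = 0"
    using h3 XY by auto
qed

lemma eta_zero: "eta S = (\<lambda>z. 0)"
  using eta_divergence by (simp add: fun_eq_iff conformal_factor)

section \<open>The Killing equations and their solution\<close>

lemma hamiltonian_partials:
  "xi S 1 = (\<lambda>z. - (1 / 4) * partial (Indep 2) hamiltonian z)"
  "xi S 2 = (\<lambda>z. (1 / 4) * partial (Indep 1) hamiltonian z)"
  using hamiltonian_horizontal
  by (auto simp: fun_eq_iff horizontal_X_def horizontal_Y_def conformal_factor(1))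

text \<open>The first two components are derivatives of a Hamiltonian that does not depend on
  \<open>t\<close>; the third is recovered from the definition of the Hamiltonian.\<close>

lemma xi_t: "partial (Indep 3) (xi S i) = (\<lambda>z. 0)"
proof -
  have 12: "partial (Indep 3) (xi S 1) = (\<lambda>z. 0)" "partial (Indep 3) (xi S 2) = (\<lambda>z. 0)"
    by (simp_all add: hamiltonian_partials partial_commute[of hamiltonian "Indep 3"] conformal_factor(1))
  moreover from this have "partial (Indep 3) (xi S 3) = (\<lambda>z. 0)"
    using conformal_factor(1) by (simp add: hamiltonian_def[abs_def])
  ultimately show ?thesis using exhaust_3[of i] by auto
qed

text \<open>On functions independent of \<open>t\<close>, the horizontal fields act as the plain
  derivatives in \<open>x\<close> and \<open>y\<close>; the first three equations are the Killing
  equations of the Euclidean plane.\<close>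

lemma xi_xy:
  "partial (Indep 1) (xi S 1) = (\<lambda>z. 0)" "partial (Indep 2) (xi S 2) = (\<lambda>z. 0)"
  "partial (Indep 1) (xi S 2) = (\<lambda>z. - partial (Indep 2) (xi S 1) z)"
  "partial (Indep 1) (xi S 3) = (\<lambda>z. 2 * xi S 2 z + 2 * z (Indep 1) * partial (Indep 2) (xi S 1) z)"
  "partial (Indep 2) (xi S 3) = (\<lambda>z. 2 * z (Indep 2) * partial (Indep 2) (xi S 1) z - 2 * xi S 1 z)"
proof -
  show 1: "partial (Indep 1) (xi S 1) = (\<lambda>z. 0)" and 2: "partial (Indep 2) (xi S 2) = (\<lambda>z. 0)"
    using conformal_factor(3,4) by (simp_all add: fun_eq_iff horizontal_X_def horizontal_Y_def xi_t)
  show 3: "partial (Indep 1) (xi S 2) = (\<lambda>z. - partial (Indep 2) (xi S 1) z)"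
    using conformal(3) by (simp add: fun_eq_iff horizontal_X_def horizontal_Y_def xi_t eq_neg_iff_add_eq_0)
  show "partial (Indep 1) (xi S 3) = (\<lambda>z. 2 * xi S 2 z + 2 * z (Indep 1) * partial (Indep 2) (xi S 1) z)"
    using conformal(4) by (simp add: fun_eq_iff horizontal_X_def horizontal_Y_def xi_t 1 3 algebra_simps)
  show "partial (Indep 2) (xi S 3) = (\<lambda>z. 2 * z (Indep 2) * partial (Indep 2) (xi S 1) z - 2 * xi S 1 z)"
    using conformal(5) by (simp add: fun_eq_iff horizontal_X_def horizontal_Y_def xi_t 2 algebra_simps)
qed

lemma eq_combination: "\<exists>a b r t. S = vf_combination a b r t"
proof -
  have comm: "partial c (partial d (xi S i)) = partial d (partial c (xi S i))" for c d i
    by (simp add: partial_commute)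
  \<comment> \<open>The Killing equations make the \<open>y\<close>-derivative of the first
    component constant: this is the rotation rate \<open>r\<close>.\<close>
  have "partial (Indep 2) (partial (Indep 2) (xi S 1)) = (\<lambda>z. - partial (Indep 2) (partial (Indep 1) (xi S 2)) z)"
    by (simp add: xi_xy(3))
  also have "\<dots> = (\<lambda>z. 0)"
    by (simp add: comm[of "Indep 2" "Indep 1"] xi_xy(2))
  finally have yy: "partial (Indep 2) (partial (Indep 2) (xi S 1)) = (\<lambda>z. 0)" .
  have "partial (Indep i) (partial (Indep 2) (xi S 1)) = (\<lambda>z. 0)" for i
    using exhaust_3[of i] yy by (auto simp: comm[of "Indep 1" "Indep 2"] comm[of "Indep 3" "Indep 2"] xi_xy(1) xi_t)
  moreover have "partial (Dep {#}) (partial (Indep 2) (xi S 1)) = (\<lambda>z. 0)"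
    by (simp add: comm[of "Dep {#}"] xi_u)
  ultimately obtain r where r: "partial (Indep 2) (xi S 1) = (\<lambda>z. r)"
    using base_function_constant[of "partial (Indep 2) (xi S 1)"] by auto
  have "partial (Indep i) (\<lambda>z. xi S 1 z - r * z (Indep 2)) = (\<lambda>z. 0)" for i
    using exhaust_3[of i] by (auto simp: xi_xy(1) xi_t r)
  moreover have "partial (Dep {#}) (\<lambda>z. xi S 1 z - r * z (Indep 2)) = (\<lambda>z. 0)"
    by (simp add: xi_u)
  ultimately obtain a where "(\<lambda>z. xi S 1 z - r * z (Indep 2)) = (\<lambda>z. a)"
    using base_function_constant[of "\<lambda>z. xi S 1 z - r * z (Indep 2)"] by auto
  then have a: "xi S 1 = (\<lambda>z. a + r * z (Indep 2))"
    by (simp add: fun_eq_iff algebra_simps)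
  have "partial (Indep i) (\<lambda>z. xi S 2 z + r * z (Indep 1)) = (\<lambda>z. 0)" for i
    using exhaust_3[of i] by (auto simp: xi_xy(2,3) xi_t r)
  moreover have "partial (Dep {#}) (\<lambda>z. xi S 2 z + r * z (Indep 1)) = (\<lambda>z. 0)"
    by (simp add: xi_u)
  ultimately obtain b where "(\<lambda>z. xi S 2 z + r * z (Indep 1)) = (\<lambda>z. b)"
    using base_function_constant[of "\<lambda>z. xi S 2 z + r * z (Indep 1)"] by auto
  then have b: "xi S 2 = (\<lambda>z. b - r * z (Indep 1))"
    by (simp add: fun_eq_iff algebra_simps)
  \<comment> \<open>In the equations for the third component the terms with \<open>r\<close> cancel,
    leaving the constant slopes \<open>2b\<close> in \<open>x\<close> and \<open>-2a\<close> in
    \<open>y\<close>.\<close>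
  let ?c = "\<lambda>z. xi S 3 z + 2 * a * z (Indep 2) - 2 * b * z (Indep 1)"
  have "partial (Indep i) ?c = (\<lambda>z. 0)" for i
    using exhaust_3[of i] by (auto simp: xi_xy(4,5) xi_t r a b algebra_simps)
  moreover have "partial (Dep {#}) ?c = (\<lambda>z. 0)"
    by (simp add: xi_u)
  ultimately obtain t where "?c = (\<lambda>z. t)"
    using base_function_constant[of ?c] by auto
  then have "xi S 3 = (\<lambda>z. t - 2 * a * z (Indep 2) + 2 * b * z (Indep 1))"
    by (simp add: fun_eq_iff algebra_simps)
  then have "S = vf_combination a b r t"
    using a b eta_zero by (intro vfield_eqI) simp_all
  then show ?thesis by blast
qed

end

theorem theorem2:
  "{S. noether_symmetry S} = lie_algebra_generated {vf_T, vf_R, vf_X, vf_Y} \<and>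
   (\<forall>S. lie_point_symmetry S \<longrightarrow>
     (noether_symmetry S \<longleftrightarrow> S \<in> lie_algebra_generated {vf_T, vf_R, vf_X, vf_Y}))"
proof -
  have "noether_symmetry S \<longleftrightarrow> S \<in> lie_algebra_generated {vf_T, vf_R, vf_X, vf_Y}" for S
    unfolding generated_combination
    using noether_field.eq_combination[OF noether_field.intro] noether_combination by blast
  then show ?thesis by blast
qed

end
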